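(* Consider a Clifford VQA on $n$ qubits with observable $O=\sum_{j=1}^N c_jP_j$, $|c_j|\le c_{\max}$, $m$ parameters, loss $L=\sum_jL_j$ with $L_j=c_j\ell_j$ and $\ell_j(\boldsymbol\phi)=\operatorname{Tr}[\rho\,U^\dagger(\boldsymbol\phi)P_jU(\boldsymbol\phi)]$. Fix an index $i$ and a partition $\{1,\dots,m\}=S\sqcup F$ of the parameter indices; write $\boldsymbol\phi=(\boldsymbol\theta,\boldsymbol\varphi)$ with $\boldsymbol\theta\in[0,2\pi)^S$ (fixed angles) and $\boldsymbol\varphi\in[0,2\pi)^F$ (null directions). Let $\boldsymbol\theta_i\in\{0,\pi/2,\pi,3\pi/2\}^S$ and assume: 1. $L_i(\boldsymbol\theta_i,\boldsymbol\varphi)=-|c_i|$ for all $\boldsymbol\varphi\in[0,2\pi)^F$; 2. there are constants $C>0$, $b>1$ such that for every $j\neq i$, $\mathbb{E}_{\boldsymbol\varphi}\big[\ell_j(\boldsymbol\theta_i,\boldsymbol\varphi)^2\big]\le C\,b^{-n}$; 3. the same bound $\mathbb{E}_{\boldsymbol\varphi}\big[\ell_j(\boldsymbol\theta',\boldsymbol\varphi)^2\big]\le C\,b^{-n}$ holds for every $j\neq i$ and every $\boldsymbol\theta'$ obtained from $\boldsymbol\theta_i$ by adding multiples of $\pi/2$ to at most two of its components. Then: (i) For $0<\epsilon\le1$ and $\boldsymbol\varphi$ sampled uniformly from $[0,2\pi)^F$, the point $(\boldsymbol\theta_i,\boldsymbol\varphi)$ is an $\epsilon$-approximate local minimum of $L$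 with probability at least $1-\mathcal{O}\big(\mathrm{poly}(N,m,c_{\max})\,C\,\epsilon^{-2}b^{-n}\big)$. (ii) For $\boldsymbol\varphi_c$ sampled uniformly from $\{0,\pi/2,\pi,3\pi/2\}^F$, the point $(\boldsymbol\theta_i,\boldsymbol\varphi_c)$ is a $0$-approximate local minimum of $L$ with probability at least $1-\mathcal{O}\big(\mathrm{poly}(N,m)\,C\,b^{-n}\big)$.
   Context: A Clifford VQA on $n$ qubits consists of: a stabilizer initial state $\rho$; an observable $O=\sum_{j=1}^N c_jP_j$ with real $c_j$ and Pauli strings $P_j$; and a circuit $U(\boldsymbol\phi)$, $\boldsymbol\phi\in[0,2\pi)^m$, which is a product of fixed Clifford gates and Pauli rotations $e^{-iQ_k\phi_k/2}$ ($Q_k$ Pauli strings), each parameter appearing in exactly one rotation. $\mathbb{E}_{\boldsymbol\varphi}$ denotes the average over $\boldsymbol\varphi$ uniform on $[0,2\pi)^F$. For $\epsilon\ge0$, a point $\boldsymbol\phi_*$ is an $\epsilon$-approximate local minimum of $L$ if $|\partial_{\phi_k}L(\boldsymbol\phi_* )|\le\epsilon$ for all $k$ and the smallest eigenvalue of the Hessian $\nabla^2L(\boldsymbol\phi_* )$ is at least $-\sqrt{\epsilon}$; thus a $0$-approximate local minimum is a point with vanishing gradient and positive semidefinite Hessian. *)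

theory Defs
  imports "HOL-Probability.Probability" "Jordan_Normal_Form.Char_Poly"
begin

definition dagger :: "complex mat \<Rightarrow> complex mat" where
  "dagger U = mat (dim_col U) (dim_row U) (\<lambda>(i,j). cnj (U $$ (j,i)))"

definition mtrace :: "complex mat \<Rightarrow> complex" where
  "mtrace M = (\<Sum>i<dim_row M. M $$ (i,i))"

definition unitary_mat :: "nat \<Rightarrow> complex mat \<Rightarrow> bool" where
  "unitary_mat d U \<longleftrightarrow> U \<in> carrier_mat d d \<and> U * dagger U = 1\<^sub>m d \<and> dagger U * U = 1\<^sub>m d"

definition pauli1 :: "nat \<Rightarrow> complex mat" where
  "pauli1 a = (if a = 1 then mat_of_rows_list 2 [[0,1],[1,0]]
               else if a = 2 then mat_of_rows_list 2 [[0,-\<i>],[\<i>,0]]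
               else if a = 3 then mat_of_rows_list 2 [[1,0],[0,-1]]
               else mat_of_rows_list 2 [[1,0],[0,1]])"

text \<open>A Pauli string on n qubits is a word p with p k < 4 for k < n (entries beyond n are
  ignored).  Its matrix is the tensor product of the single-qubit Paulis, written out
  entrywise (qubit k corresponds to bit k of the computational basis index).\<close>
definition is_pauli :: "nat \<Rightarrow> (nat \<Rightarrow> nat) \<Rightarrow> bool" where
  "is_pauli n p \<longleftrightarrow> (\<forall>k<n. p k < 4)"

definition pauli_mat :: "nat \<Rightarrow> (nat \<Rightarrow> nat) \<Rightarrow> complex mat" where
  "pauli_mat n p = mat (2^n) (2^n)
     (\<lambda>(r,c). \<Prod>k<n. pauli1 (p k) $$ (r div 2^k mod 2, c div 2^k mod 2))"

definition clifford :: "nat \<Rightarrow> complex mat \<Rightarrow> bool" where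
  "clifford n U \<longleftrightarrow> unitary_mat (2^n) U \<and>
     (\<forall>p. is_pauli n p \<longrightarrow> (\<exists>q s. is_pauli n q \<and> s \<in> {1, -1, \<i>, -\<i>} \<and>
          U * pauli_mat n p * dagger U = s \<cdot>\<^sub>m pauli_mat n q))"

definition stabilizer_state :: "nat \<Rightarrow> complex mat \<Rightarrow> bool" where
  "stabilizer_state n \<rho> \<longleftrightarrow> (\<exists>V. clifford n V \<and>
     (let \<psi> = V *\<^sub>v unit_vec (2^n) 0 in
        \<rho> = mat (2^n) (2^n) (\<lambda>(r,c). \<psi> $ r * cnj (\<psi> $ c))))"

datatype gate = Cliff "complex mat" | Rot "nat \<Rightarrow> nat" nat
  \<comment> \<open>Rot Q k is the Pauli rotation exp(-i Q phi_k / 2)\<close>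

text \<open>exp(-i Q t/2) = cos(t/2) I - i sin(t/2) Q, since Q^2 = I.\<close>
definition pauli_rot :: "nat \<Rightarrow> (nat \<Rightarrow> nat) \<Rightarrow> real \<Rightarrow> complex mat" where
  "pauli_rot n Q t = complex_of_real (cos (t/2)) \<cdot>\<^sub>m 1\<^sub>m (2^n)
                     + (- \<i> * complex_of_real (sin (t/2))) \<cdot>\<^sub>m pauli_mat n Q"

fun gate_mat :: "nat \<Rightarrow> (nat \<Rightarrow> real) \<Rightarrow> gate \<Rightarrow> complex mat" where
  "gate_mat n \<phi> (Cliff U) = U"
| "gate_mat n \<phi> (Rot Q k) = pauli_rot n Q (\<phi> k)"

text \<open>The circuit [g1,...,gL] implements U(phi) = G_L ... G_1 (g1 acts first).\<close>
definition circuit_mat :: "nat \<Rightarrow> gate list \<Rightarrow> (nat \<Rightarrow> real) \<Rightarrow> complex mat" where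
  "circuit_mat n gs \<phi> = foldl (\<lambda>M g. gate_mat n \<phi> g * M) (1\<^sub>m (2^n)) gs"

fun rot_index :: "gate \<Rightarrow> nat option" where
  "rot_index (Cliff U) = None"
| "rot_index (Rot Q k) = Some k"

definition valid_gate :: "nat \<Rightarrow> nat \<Rightarrow> gate \<Rightarrow> bool" where
  "valid_gate n m g = (case g of Cliff U \<Rightarrow> clifford n U | Rot Q k \<Rightarrow> is_pauli n Q \<and> k < m)"

definition clifford_circuit :: "nat \<Rightarrow> nat \<Rightarrow> gate list \<Rightarrow> bool" where
  "clifford_circuit n m gs \<longleftrightarrow> (\<forall>g\<in>set gs. valid_gate n m g) \<and>
     (\<forall>k<m. length (filter (\<lambda>g. rot_index g = Some k) gs) = 1)"

text \<open>ell_j(phi) = Tr[rho U^dagger(phi) P U(phi)] (a real number; we take the real part).\<close>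
definition ell :: "nat \<Rightarrow> complex mat \<Rightarrow> gate list \<Rightarrow> (nat \<Rightarrow> nat) \<Rightarrow> (nat \<Rightarrow> real) \<Rightarrow> real" where
  "ell n \<rho> gs P \<phi> = Re (mtrace (\<rho> * dagger (circuit_mat n gs \<phi>) * pauli_mat n P * circuit_mat n gs \<phi>))"

definition loss :: "nat \<Rightarrow> complex mat \<Rightarrow> gate list \<Rightarrow> nat \<Rightarrow> (nat \<Rightarrow> real) \<Rightarrow> (nat \<Rightarrow> nat \<Rightarrow> nat)
                    \<Rightarrow> (nat \<Rightarrow> real) \<Rightarrow> real" where
  "loss n \<rho> gs N c P \<phi> = (\<Sum>j<N. c j * ell n \<rho> gs (P j) \<phi>)"

definition partial :: "nat \<Rightarrow> ((nat \<Rightarrow> real) \<Rightarrow> real) \<Rightarrow> (nat \<Rightarrow> real) \<Rightarrow> real" where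
  "partial k f \<phi> = deriv (\<lambda>t. f (\<phi>(k := t))) (\<phi> k)"

definition hessian :: "nat \<Rightarrow> ((nat \<Rightarrow> real) \<Rightarrow> real) \<Rightarrow> (nat \<Rightarrow> real) \<Rightarrow> real mat" where
  "hessian m f \<phi> = mat m m (\<lambda>(k,l). partial k (partial l f) \<phi>)"

definition approx_local_min :: "nat \<Rightarrow> real \<Rightarrow> ((nat \<Rightarrow> real) \<Rightarrow> real) \<Rightarrow> (nat \<Rightarrow> real) \<Rightarrow> bool" where
  "approx_local_min m \<epsilon> f \<phi> \<longleftrightarrow>
     (\<forall>k<m. \<bar>partial k f \<phi>\<bar> \<le> \<epsilon>) \<and>
     (\<forall>ev. eigenvalue (hessian m f \<phi>) ev \<longrightarrow> ev \<ge> - sqrt \<epsilon>)"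

definition join :: "nat set \<Rightarrow> (nat \<Rightarrow> real) \<Rightarrow> (nat \<Rightarrow> real) \<Rightarrow> (nat \<Rightarrow> real)" where
  "join F \<theta> \<phi> = (\<lambda>k. if k \<in> F then \<phi> k else \<theta> k)"

definition clifford_angles :: "real set" where
  "clifford_angles = {0, pi/2, pi, 3*pi/2}"

definition unif_F :: "nat set \<Rightarrow> (nat \<Rightarrow> real) measure" where
  "unif_F F = PiM F (\<lambda>_. uniform_measure lborel {0..<2*pi})"

definition unif_clifford_F :: "nat set \<Rightarrow> (nat \<Rightarrow> real) pmf" where
  "unif_clifford_F F = pmf_of_set (PiE F (\<lambda>_. clifford_angles))"

end

theory Submission
  imports Defs
begin

text \<open>
  Conjugating an observable by a Pauli rotation gives an expression affine in \<open>cos \<phi>\<^sub>k\<close> and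
  \<open>sin \<phi>\<^sub>k\<close>, so every \<open>\<ell>\<^sub>j\<close> is a multilinear trigonometric polynomial. For such functions the
  parameter-shift rule holds, and the mean square over the torus equals the mean square over the grid
  of Clifford angles. Differentiating in a free direction does not increase the mean square;
  differentiating in a fixed direction costs one shift by \<open>\<pi>/2\<close>. Hence all first and second
  derivatives of \<open>\<ell>\<^sub>j\<close>, \<open>j \<noteq> i\<close>, have mean square at most \<open>C b\<^sup>-\<^sup>n\<close>, and Markov's
  inequality makes them all small with high probability. Since \<open>L\<^sub>i\<close> is at its global minimum,
  its gradient vanishes and its Hessian is positive semidefinite, which gives (i). At Clifford angles the
  derivatives lie in \<open>\<int>/4\<close>, so small means zero, which gives (ii).
\<close>

subsection \<open>Multilinear trigonometric polynomials\<close>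

text \<open>Torus and Clifford-grid averages agree because the square of a multilinear trigonometric
  polynomial has frequency at most two in each angle, and four equally spaced points integrate every
  frequency below four exactly. Two shifted components suffice because a Hessian entry takes two
  derivatives and each one, if taken in a fixed direction, touches one component of
  \<open>\<theta>\<close>. The denominator 4 arises because stabilizer expectations at Clifford
  angles are integers and each use of the shift rule halves a difference. The obstacle in the
  continuous case is not analytic: \<open>measure\<close> is 0 on non-measurable sets, so a lower
  bound on the probability needs the eigenvalue condition to define a measurable event. The exponent
  9 is 3 + 6: at most a cubic number of derivatives enters the union bound, and the threshold is
  \<open>\<epsilon>\<close> over a cubic quantity, which Markov's inequality squares.\<close>

text \<open>Angles are peeled off one at a time instead of listing 3^|K| coefficients, so each fact
  below is an induction with one cosine and one sine. The condition \<open>k \<notin> K\<close>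
  makes the three coefficients independent of \<open>\<phi> k\<close>.\<close>

inductive multi_trig :: "nat set \<Rightarrow> ((nat \<Rightarrow> real) \<Rightarrow> real) \<Rightarrow> bool" where
  const: "multi_trig {} (\<lambda>_. c)"
| step: "k \<notin> K \<Longrightarrow> multi_trig K f0 \<Longrightarrow> multi_trig K f1 \<Longrightarrow> multi_trig K f2 \<Longrightarrow>
         multi_trig (insert k K) (\<lambda>\<phi>. f0 \<phi> + cos (\<phi> k) * f1 \<phi> + sin (\<phi> k) * f2 \<phi>)"

lemma multi_trig_finite: "multi_trig K f \<Longrightarrow> finite K"
  by (induction rule: multi_trig.induct) auto

lemma multi_trig_const: "finite K \<Longrightarrow> multi_trig K (\<lambda>_. c)"
proof (induction K rule: finite_induct)
  case empty
  show ?case by (rule multi_trig.const)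
next
  case (insert k K)
  \<comment> \<open>The cosine and sine coefficients of a constant are the zero function, so zero
    has to be covered before a general \<open>c\<close>.\<close>
  have "multi_trig K (\<lambda>_. 0)" if "finite K" for K
    using that
  proof (induction K rule: finite_induct)
    case (insert k K)
    from multi_trig.step[OF insert(2) insert(3) insert(3) insert(3)] show ?case by simp
  qed (rule multi_trig.const)
  from multi_trig.step[OF insert(2) insert(3) this this] insert(1) show ?case by simp
qed

lemma multi_trig_upd:
  assumes "multi_trig K f" "k \<notin> K"
  shows "f (\<phi>(k := t)) = f \<phi>"
  using assms by (induction rule: multi_trig.induct) auto

text \<open>The nesting singles out one outermost angle; here the choice becomes free. If
  \<open>k\<close> sits deeper, the affine forms of the three parts combine linearly with
  coefficients that do not involve \<open>t\<close>.\<close>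

lemma multi_trig_coord:
  assumes "multi_trig K f"
  shows "\<exists>A B D. \<forall>t. f (\<phi>(k := t)) = A + B * cos t + D * sin t"
  using assms
proof (induction rule: multi_trig.induct)
  case (const c)
  show ?case by (rule exI[of _ c], rule exI[of _ 0], rule exI[of _ 0]) simp
next
  case (step j K f0 f1 f2)
  show ?case
  proof (cases "k = j")
    case True
    have upd: "f0 (\<phi>(j := t)) = f0 \<phi>" "f1 (\<phi>(j := t)) = f1 \<phi>" "f2 (\<phi>(j := t)) = f2 \<phi>" for t
      using step(1-4) by (auto intro: multi_trig_upd)
    show ?thesis unfolding True
      by (rule exI[of _ "f0 \<phi>"], rule exI[of _ "f1 \<phi>"], rule exI[of _ "f2 \<phi>"])
         (simp only: upd fun_upd_same mult.commute simp_thms)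
  next
    case False
    from step.IH obtain A0 B0 D0 A1 B1 D1 A2 B2 D2 where
      "\<forall>t. f0 (\<phi>(k := t)) = A0 + B0 * cos t + D0 * sin t"
      "\<forall>t. f1 (\<phi>(k := t)) = A1 + B1 * cos t + D1 * sin t"
      "\<forall>t. f2 (\<phi>(k := t)) = A2 + B2 * cos t + D2 * sin t" by blast
    then have "\<forall>t. f0 (\<phi>(k := t)) + cos (\<phi> j) * f1 (\<phi>(k := t)) + sin (\<phi> j) * f2 (\<phi>(k := t))
      = (A0 + cos (\<phi> j) * A1 + sin (\<phi> j) * A2) + (B0 + cos (\<phi> j) * B1 + sin (\<phi> j) * B2) * cos t
        + (D0 + cos (\<phi> j) * D1 + sin (\<phi> j) * D2) * sin t"
      by (simp only:) (simp add: algebra_simps)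
    moreover have "(\<phi>(k := t)) j = \<phi> j" for t using False by simp
    ultimately show ?thesis by (simp only:) blast
  qed
qed

section \<open>Partial derivatives and the parameter-shift rule\<close>

lemma partial_eqI:
  assumes "((\<lambda>t. f (\<phi>(k := t))) has_real_derivative D) (at (\<phi> k))"
  shows "partial k f \<phi> = D"
  using assms by (simp add: partial_def DERIV_imp_deriv)

lemma partial_coord:
  assumes "\<forall>t. f (\<phi>(k := t)) = A + B * cos t + D * sin t"
  shows "partial k f (\<phi>(k := t)) = - B * sin t + D * cos t"
  by (rule partial_eqI) (auto simp: assms intro!: derivative_eq_intros)

lemma multi_trig_partial_DERIV:
  assumes "multi_trig K f"
  shows "((\<lambda>t. f (\<phi>(k := t))) has_real_derivative partial k f \<phi>) (at (\<phi> k))"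
proof -
  obtain A B D where *: "\<forall>t. f (\<phi>(k := t)) = A + B * cos t + D * sin t"
    using multi_trig_coord[OF assms] by blast
  have "partial k f \<phi> = - B * sin (\<phi> k) + D * cos (\<phi> k)"
    using partial_coord[OF *, of "\<phi> k"] by simp
  then show ?thesis by (auto simp: * intro!: derivative_eq_intros)
qed

text \<open>A quarter-period shift turns cosine and sine into each other up to sign, and the
  constant term cancels in the difference. As only frequency one is present, the finite difference
  is exact.\<close>

lemma multi_trig_parameter_shift:
  assumes "multi_trig K f"
  shows "partial k f \<phi> = (f (\<phi>(k := \<phi> k + pi/2)) - f (\<phi>(k := \<phi> k - pi/2))) / 2"
proof -
  obtain A B D where *: "\<forall>t. f (\<phi>(k := t)) = A + B * cos t + D * sin t"
    using multi_trig_coord[OF assms] by blast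
  have "partial k f \<phi> = - B * sin (\<phi> k) + D * cos (\<phi> k)"
    using partial_coord[OF *, of "\<phi> k"] by simp
  then show ?thesis by (simp add: * cos_add sin_add cos_diff sin_diff)
qed

text \<open>The explicit 0 and the sign inside the sine term keep the result in the shape that
  \<open>multi_trig.step\<close> produces.\<close>

lemma partial_step_same:
  assumes "k \<notin> K" "multi_trig K f0" "multi_trig K f1" "multi_trig K f2"
  shows "partial k (\<lambda>\<phi>. f0 \<phi> + cos (\<phi> k) * f1 \<phi> + sin (\<phi> k) * f2 \<phi>)
    = (\<lambda>\<phi>. 0 + cos (\<phi> k) * f2 \<phi> + sin (\<phi> k) * (- f1 \<phi>))"
proof
  fix \<phi>
  show "partial k (\<lambda>\<phi>. f0 \<phi> + cos (\<phi> k) * f1 \<phi> + sin (\<phi> k) * f2 \<phi>) \<phi>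
    = 0 + cos (\<phi> k) * f2 \<phi> + sin (\<phi> k) * (- f1 \<phi>)"
    by (rule partial_eqI)
       (use assms in \<open>auto simp: multi_trig_upd intro!: derivative_eq_intros\<close>)
qed

lemma partial_step_other:
  assumes "k \<noteq> l" "multi_trig K f0" "multi_trig K f1" "multi_trig K f2"
  shows "partial l (\<lambda>\<phi>. f0 \<phi> + cos (\<phi> k) * f1 \<phi> + sin (\<phi> k) * f2 \<phi>)
    = (\<lambda>\<phi>. partial l f0 \<phi> + cos (\<phi> k) * partial l f1 \<phi> + sin (\<phi> k) * partial l f2 \<phi>)"
proof
  fix \<phi>
  note [derivative_intros] = multi_trig_partial_DERIV[OF assms(2)]
    multi_trig_partial_DERIV[OF assms(3)] multi_trig_partial_DERIV[OF assms(4)]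
  show "partial l (\<lambda>\<phi>. f0 \<phi> + cos (\<phi> k) * f1 \<phi> + sin (\<phi> k) * f2 \<phi>) \<phi>
    = partial l f0 \<phi> + cos (\<phi> k) * partial l f1 \<phi> + sin (\<phi> k) * partial l f2 \<phi>"
    by (rule partial_eqI)
       (use assms(1) in \<open>auto intro!: derivative_eq_intros\<close>)
qed

lemma partial_notin:
  assumes "multi_trig K f" "k \<notin> K"
  shows "partial k f = (\<lambda>_. 0)"
  by (rule ext, rule partial_eqI) (simp add: multi_trig_upd[OF assms])

lemma multi_trig_cmult: "multi_trig K f \<Longrightarrow> multi_trig K (\<lambda>\<phi>. a * f \<phi>)"
proof (induction rule: multi_trig.induct)
  case (step k K f0 f1 f2)
  from multi_trig.step[OF step(1) step.IH] show ?case by (simp add: algebra_simps)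
qed (rule multi_trig.const)

lemma multi_trig_partial:
  assumes "multi_trig K f"
  shows "multi_trig K (partial k f)"
  using assms
proof (induction rule: multi_trig.induct)
  case (const c)
  show ?case using partial_notin[OF multi_trig.const[of c], of k]
    by (auto intro: multi_trig.const)
next
  case (step j K f0 f1 f2)
  show ?case
  proof (cases "j = k")
    case True
    show ?thesis
      using multi_trig.step[OF step(1) multi_trig_const step(4) multi_trig_cmult[OF step(3)], of 0 "-1"]
        partial_step_same[OF step(1-4)] True multi_trig_finite[OF step(2)] by simp
  next
    case False
    then show ?thesis
      using multi_trig.step[OF step(1) step.IH] partial_step_other[OF False step(2-4)] by simp
  qed
qed

text \<open>Existence of partial derivatives alone would not give a chain rule along lines;
  induction on the nesting does, without a total derivative on
  \<open>nat \<Rightarrow> real\<close>.\<close>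

lemma multi_trig_chain:
  assumes "multi_trig K f"
  shows "((\<lambda>t. f (\<lambda>k. \<phi> k + t * v k)) has_real_derivative
    (\<Sum>k\<in>K. v k * partial k f (\<lambda>k. \<phi> k + t * v k))) (at t)"
  using assms
proof (induction rule: multi_trig.induct)
  case (step j K f0 f1 f2)
  let ?x = "\<lambda>k. \<phi> k + t * v k"
  note [derivative_intros] = step.IH
  have fin: "finite K" using multi_trig_finite step(2) .
  have "(\<Sum>k\<in>K. v k * partial k (\<lambda>\<phi>. f0 \<phi> + cos (\<phi> j) * f1 \<phi> + sin (\<phi> j) * f2 \<phi>) ?x)
     = (\<Sum>k\<in>K. v k * (partial k f0 ?x + cos (?x j) * partial k f1 ?x + sin (?x j) * partial k f2 ?x))"
    by (rule sum.cong[OF refl], subst partial_step_other[OF _ step(2-4)]) (use step(1) in auto)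
  also have "\<dots> = (\<Sum>k\<in>K. v k * partial k f0 ?x) + cos (?x j) * (\<Sum>k\<in>K. v k * partial k f1 ?x)
       + sin (?x j) * (\<Sum>k\<in>K. v k * partial k f2 ?x)"
    by (simp add: algebra_simps sum.distrib sum_distrib_left)
  finally have eq: "(\<Sum>k\<in>insert j K. v k * partial k (\<lambda>\<phi>. f0 \<phi> + cos (\<phi> j) * f1 \<phi> + sin (\<phi> j) * f2 \<phi>) ?x)
    = v j * (cos (?x j) * f2 ?x - sin (?x j) * f1 ?x)
     + ((\<Sum>k\<in>K. v k * partial k f0 ?x) + cos (?x j) * (\<Sum>k\<in>K. v k * partial k f1 ?x)
       + sin (?x j) * (\<Sum>k\<in>K. v k * partial k f2 ?x))"
    using step(1) fin by (simp add: partial_step_same[OF step(1-4)])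
  show ?case unfolding eq
    by (auto intro!: derivative_eq_intros simp: algebra_simps)
qed simp

section \<open>Second-order conditions at a global minimum\<close>

text \<open>If \<open>g2 < 0\<close>, then \<open>g'\<close>, which vanishes at the minimum, is
  negative just to the right of 0, and the mean value theorem puts \<open>g\<close> below its
  minimum there.\<close>

lemma second_derivative_nonneg_at_min:
  fixes g :: "real \<Rightarrow> real"
  assumes g: "\<And>t. (g has_real_derivative g' t) (at t)"
    and g': "(g' has_real_derivative g2) (at 0)"
    and min: "\<And>t. g 0 \<le> g t"
  shows "g2 \<ge> 0"
proof (rule ccontr)
  assume "\<not> g2 \<ge> 0"
  then have "g2 < 0" by simp
  from DERIV_neg_dec_right[OF g' this] obtain d where
    d: "d > 0" "\<And>h. 0 < h \<Longrightarrow> h < d \<Longrightarrow> g' h < g' 0" by auto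
  have "g' 0 = 0"
    using DERIV_local_min[OF g, of 1 0] min by simp
  with d have neg: "g' h < 0" if "0 < h" "h < d" for h using that by fastforce
  obtain z where z: "0 < z" "z < d/2" "g (d/2) - g 0 = (d/2 - 0) * g' z"
    using MVT2[of 0 "d/2" g g'] g d(1) by auto
  have "(d/2 - 0) * g' z < 0" using neg[of z] z d(1) by (simp add: mult_pos_neg)
  with min[of "d/2"] z(3) show False by linarith
qed

lemma multi_trig_partial_zero_at_min:
  assumes "multi_trig K f" and min: "\<And>y. f x \<le> f y"
  shows "partial k f x = 0"
  using DERIV_local_min[OF multi_trig_partial_DERIV[OF assms(1)], of 1 x k] min by simp

text \<open>The quadratic form is the second derivative at 0 of \<open>f\<close> restricted to the
  line through \<open>x\<close> with direction \<open>v\<close>, and this restriction has its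
  minimum at 0.\<close>

lemma multi_trig_hessian_at_min:
  assumes f: "multi_trig K f" and min: "\<And>y. f x \<le> f y"
  shows "(\<Sum>k\<in>K. \<Sum>l\<in>K. v k * v l * partial k (partial l f) x) \<ge> 0"
proof -
  let ?x = "\<lambda>t k. x k + t * v k"
  have "((\<lambda>t. \<Sum>l\<in>K. v l * partial l f (?x t)) has_real_derivative
     (\<Sum>l\<in>K. v l * (\<Sum>k\<in>K. v k * partial k (partial l f) (?x 0)))) (at 0)"
    using multi_trig_chain[OF multi_trig_partial[OF f]] by (intro DERIV_sum DERIV_cmult)
  from second_derivative_nonneg_at_min[OF multi_trig_chain[OF f] this] min
  have "0 \<le> (\<Sum>l\<in>K. v l * (\<Sum>k\<in>K. v k * partial k (partial l f) x))" by simp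
  also have "\<dots> = (\<Sum>l\<in>K. \<Sum>k\<in>K. v k * v l * partial k (partial l f) x)"
    by (simp add: sum_distrib_left mult_ac)
  also have "\<dots> = (\<Sum>k\<in>K. \<Sum>l\<in>K. v k * v l * partial k (partial l f) x)"
    by (rule sum.swap)
  finally show ?thesis .
qed

text \<open>Serves to move arbitrary real angles into \<open>{0..<2*pi}\<close>.\<close>

lemma multi_trig_periodic:
  assumes "multi_trig K f" "\<And>k. k \<in> K \<Longrightarrow> cos (x k) = cos (y k) \<and> sin (x k) = sin (y k)"
  shows "f x = f y"
  using assms by (induction rule: multi_trig.induct) auto

lemma multi_trig_measurable:
  assumes "multi_trig K f" and "\<And>k. (\<lambda>\<omega>. X \<omega> k) \<in> borel_measurable M"
  shows "(\<lambda>\<omega>. f (X \<omega>)) \<in> borel_measurable M"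
  using assms(1)
proof (induction rule: multi_trig.induct)
  case (step k K f0 f1 f2)
  note [measurable] = step.IH assms(2)
  show ?case by measurable
qed simp

lemma multi_trig_bounded:
  assumes "multi_trig K f"
  shows "\<exists>B. \<forall>x. \<bar>f x\<bar> \<le> B"
  using assms
proof (induction rule: multi_trig.induct)
  case (step k K f0 f1 f2)
  then obtain B0 B1 B2 where B: "\<forall>x. \<bar>f0 x\<bar> \<le> B0" "\<forall>x. \<bar>f1 x\<bar> \<le> B1" "\<forall>x. \<bar>f2 x\<bar> \<le> B2" by blast
  have "\<bar>f0 x + cos (x k) * f1 x + sin (x k) * f2 x\<bar> \<le> B0 + B1 + B2" for x
  proof -
    have "\<bar>cos (x k) * f1 x\<bar> \<le> 1 * B1" "\<bar>sin (x k) * f2 x\<bar> \<le> 1 * B2"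
      unfolding abs_mult by (intro mult_mono; simp add: B)+
    then show ?thesis using B(1)[rule_format, of x] by linarith
  qed
  then show ?case by blast
qed auto

subsection \<open>Clifford circuits\<close>

lemma mat_mult_entry:
  assumes "A \<in> carrier_mat a b" "B \<in> carrier_mat b c" "i < a" "j < c"
  shows "(A * B) $$ (i,j) = (\<Sum>k<b. A $$ (i,k) * B $$ (k,j))"
  using assms by (auto simp: scalar_prod_def atLeast0LessThan intro!: sum.cong)

lemma dagger_carrier [simp, intro]: "A \<in> carrier_mat a b \<Longrightarrow> dagger A \<in> carrier_mat b a"
  by (auto simp: dagger_def)

lemma dagger_entry:
  "A \<in> carrier_mat a b \<Longrightarrow> i < b \<Longrightarrow> j < a \<Longrightarrow> dagger A $$ (i,j) = cnj (A $$ (j,i))"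
  by (auto simp: dagger_def)

lemma dagger_mult:
  assumes A: "A \<in> carrier_mat a b" and B: "B \<in> carrier_mat b c"
  shows "dagger (A * B) = dagger B * dagger A"
proof (rule eq_matI)
  fix i j assume "i < dim_row (dagger B * dagger A)" "j < dim_col (dagger B * dagger A)"
  then have i: "i < c" and j: "j < a" using A B by (auto simp: dagger_def)
  have "dagger (A * B) $$ (i,j) = cnj (\<Sum>k<b. A $$ (j,k) * B $$ (k,i))"
    using dagger_entry[OF mult_carrier_mat[OF A B] i j] mat_mult_entry[OF A B j i] by simp
  also have "\<dots> = (\<Sum>k<b. dagger B $$ (i,k) * dagger A $$ (k,j))"
    unfolding cnj_sum by (rule sum.cong[OF refl])
      (use i j in \<open>simp add: dagger_entry[OF A] dagger_entry[OF B]\<close>)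
  also have "\<dots> = (dagger B * dagger A) $$ (i,j)"
    using mat_mult_entry[OF dagger_carrier[OF B] dagger_carrier[OF A] i j] by simp
  finally show "dagger (A * B) $$ (i,j) = (dagger B * dagger A) $$ (i,j)" .
qed (use A B in \<open>auto simp: dagger_def\<close>)

lemma dagger_one: "dagger (1\<^sub>m n) = 1\<^sub>m n"
  by (rule eq_matI) (auto simp: dagger_def)

lemma mtrace_add_smult:
  assumes "A \<in> carrier_mat d d" "B \<in> carrier_mat d d" "D \<in> carrier_mat d d"
  shows "mtrace (A + a \<cdot>\<^sub>m B + b \<cdot>\<^sub>m D) = mtrace A + a * mtrace B + b * mtrace D"
  using assms by (simp add: mtrace_def sum.distrib sum_distrib_left)

lemma mult_lincomb_mult:
  fixes X :: "complex mat"
  assumes "X \<in> carrier_mat d d" "Y \<in> carrier_mat d d"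
    "A \<in> carrier_mat d d" "B \<in> carrier_mat d d" "D \<in> carrier_mat d d"
  shows "X * (A + a \<cdot>\<^sub>m B + b \<cdot>\<^sub>m D) * Y = X * A * Y + a \<cdot>\<^sub>m (X * B * Y) + b \<cdot>\<^sub>m (X * D * Y)"
proof -
  have c: "X * A \<in> carrier_mat d d" "X * B \<in> carrier_mat d d" "X * D \<in> carrier_mat d d"
    using assms by auto
  have "X * (A + a \<cdot>\<^sub>m B + b \<cdot>\<^sub>m D) = X * A + a \<cdot>\<^sub>m (X * B) + b \<cdot>\<^sub>m (X * D)"
    using assms c by (simp add: mult_add_distrib_mat[where nr = d and n = d and nc = d]
      mult_smult_distrib[where nr = d and n = d and nc = d] del: assoc_add_mat)
  moreover have "\<dots> * Y = X * A * Y + a \<cdot>\<^sub>m (X * B * Y) + b \<cdot>\<^sub>m (X * D * Y)"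
    using assms c by (simp add: add_mult_distrib_mat[where n = d and nr = d and nc = d]
      mult_smult_assoc_mat[where n = d and nr = d and nc = d] del: assoc_mult_mat assoc_add_mat)
  ultimately show ?thesis by simp
qed

lemma affine_sandwich:
  fixes Q :: "complex mat"
  assumes Q: "Q \<in> carrier_mat d d" and M: "M \<in> carrier_mat d d"
  shows "(\<alpha> \<cdot>\<^sub>m 1\<^sub>m d + \<beta> \<cdot>\<^sub>m Q) * M * (\<gamma> \<cdot>\<^sub>m 1\<^sub>m d + \<delta> \<cdot>\<^sub>m Q)
    = (\<alpha> * \<gamma>) \<cdot>\<^sub>m M + (\<alpha> * \<delta>) \<cdot>\<^sub>m (M * Q) + (\<beta> * \<gamma>) \<cdot>\<^sub>m (Q * M) + (\<beta> * \<delta>) \<cdot>\<^sub>m (Q * M * Q)"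
proof -
  \<comment> \<open>Naming the products keeps them from being reassociated, so the final comparison
    of entries is linear in opaque matrices.\<close>
  define X where "X = Q * M"
  have X: "X \<in> carrier_mat d d" using assms by (simp add: X_def)
  define MQ where "MQ = M * Q"
  define XQ where "XQ = X * Q"
  have c: "MQ \<in> carrier_mat d d" "XQ \<in> carrier_mat d d" using assms X by (simp_all add: MQ_def XQ_def)
  have 1: "(\<alpha> \<cdot>\<^sub>m 1\<^sub>m d + \<beta> \<cdot>\<^sub>m Q) * M = \<alpha> \<cdot>\<^sub>m M + \<beta> \<cdot>\<^sub>m X"
    using assms by (simp add: X_def add_mult_distrib_mat[where n = d and nr = d and nc = d]
      mult_smult_assoc_mat[where n = d and nr = d and nc = d])
  let ?Y = "\<alpha> \<cdot>\<^sub>m M + \<beta> \<cdot>\<^sub>m X"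
  have Y: "?Y \<in> carrier_mat d d" using M X by simp
  have 2: "?Y * (\<gamma> \<cdot>\<^sub>m 1\<^sub>m d + \<delta> \<cdot>\<^sub>m Q) = \<gamma> \<cdot>\<^sub>m ?Y + \<delta> \<cdot>\<^sub>m (?Y * Q)"
    using Y Q by (simp add: right_mult_one_mat[OF Y] mult_add_distrib_mat[where nr = d and n = d and nc = d] mult_smult_distrib[where nr = d and n = d and nc = d])
  have 3: "?Y * Q = \<alpha> \<cdot>\<^sub>m MQ + \<beta> \<cdot>\<^sub>m XQ"
    unfolding MQ_def XQ_def
    using M X Q by (simp add: add_mult_distrib_mat[where n = d and nr = d and nc = d]
      mult_smult_assoc_mat[where n = d and nr = d and nc = d])
  show ?thesis
    unfolding 1 2 3 X_def[symmetric] MQ_def[symmetric] XQ_def[symmetric]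
    by (rule eq_matI) (use M X c in \<open>auto simp: algebra_simps\<close>)
qed

section \<open>Pauli strings\<close>

text \<open>A sum over basis indices is a sum over bit strings, so it factorises qubit by qubit; the
  induction splits the indices by their top bit. Products and traces of Pauli strings reduce to
  single qubits this way.\<close>

lemma sum_prod_bits:
  fixes g :: "nat \<Rightarrow> nat \<Rightarrow> 'a :: comm_ring_1"
  shows "(\<Sum>r<2^n. \<Prod>k<n. g k (r div 2^k mod 2)) = (\<Prod>k<n. g k 0 + g k 1)"
proof (induction n)
  case (Suc n)
  let ?h = "\<lambda>r. \<Prod>k<n. g k (r div 2^k mod 2)"
  have low: "(r + 2^n) div 2^k mod 2 = r div 2^k mod 2" if "k < n" for r k :: nat
  proof -
    from that obtain i where "n = k + Suc i" using less_imp_Suc_add by auto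
    then have "r + 2^n = r + (2 * 2^i) * 2^k" by (simp add: power_add)
    then have "(r + 2^n) div 2^k = 2 * 2^i + r div 2^k"
      by (simp only:) (rule div_mult_self1, simp)
    then show ?thesis by simp
  qed
  have split: "{..<2 ^ Suc n} = {..<2^n} \<union> (\<lambda>r. r + 2^n) ` {..<2^n::nat}"
  proof (intro equalityI subsetI)
    fix x :: nat assume "x \<in> {..<2 ^ Suc n}"
    then show "x \<in> {..<2^n} \<union> (\<lambda>r. r + 2^n) ` {..<2^n::nat}"
      by (cases "x < 2^n") (auto intro!: image_eqI[of _ _ "x - 2^n"])
  qed auto
  have "(\<Sum>r<2^Suc n. \<Prod>k<Suc n. g k (r div 2^k mod 2))
     = (\<Sum>r<2^n. \<Prod>k<Suc n. g k (r div 2^k mod 2))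
     + (\<Sum>r\<in>(\<lambda>r. r + 2^n) ` {..<2^n}. \<Prod>k<Suc n. g k (r div 2^k mod 2))"
    unfolding split by (rule sum.union_disjoint) auto
  also have "(\<Sum>r<2^n. \<Prod>k<Suc n. g k (r div 2^k mod 2)) = (\<Sum>r<2^n. ?h r * g n 0)"
    by (rule sum.cong) auto
  also have "(\<Sum>r\<in>(\<lambda>r. r + 2^n) ` {..<2^n}. \<Prod>k<Suc n. g k (r div 2^k mod 2)) = (\<Sum>r<2^n. ?h r * g n 1)"
    by (subst sum.reindex) (auto simp: inj_on_def low intro!: sum.cong prod.cong)
  also have "(\<Sum>r<2^n. ?h r * g n 0) + (\<Sum>r<2^n. ?h r * g n 1) = (\<Sum>r<2^n. ?h r) * (g n 0 + g n 1)"
    by (simp add: algebra_simps sum_distrib_left sum_distrib_right sum.distrib)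
  finally show ?case using Suc by (simp add: mult.commute)
qed simp

lemma bits_eqI:
  fixes r c :: nat
  assumes "r < 2^n" "c < 2^n" "\<And>k. k < n \<Longrightarrow> r div 2^k mod 2 = c div 2^k mod 2"
  shows "r = c"
proof (rule bit_eqI)
  fix k
  have "r < 2^k" "c < 2^k" if "n \<le> k"
    using that assms(1,2) power_increasing[of n k "2::nat"] by linarith+
  then show "bit r k = bit c k"
    using assms(3)[of k] by (cases "k < n") (auto simp: bit_iff_odd odd_iff_mod_2_eq_one)
qed

lemma pauli1_entry:
  "pauli1 a $$ (0,0) = (if a = 1 \<or> a = 2 then 0 else 1)"
  "pauli1 a $$ (0,Suc 0) = (if a = 1 then 1 else if a = 2 then - \<i> else 0)"
  "pauli1 a $$ (Suc 0,0) = (if a = 1 then 1 else if a = 2 then \<i> else 0)"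
  "pauli1 a $$ (Suc 0,Suc 0) = (if a = 1 \<or> a = 2 then 0 else if a = 3 then -1 else 1)"
  by (auto simp: pauli1_def mat_of_rows_list_def)

text \<open>An entry of the 2 by 2 matrix product as a bare scalar expression, which makes the
  single-qubit facts finite case checks.\<close>

definition pauli1_prod :: "nat \<Rightarrow> nat \<Rightarrow> nat \<Rightarrow> nat \<Rightarrow> complex" where
  "pauli1_prod a b i j = pauli1 a $$ (i,0) * pauli1 b $$ (0,j) + pauli1 a $$ (i,1) * pauli1 b $$ (1,j)"

abbreviation quarter_phases :: "complex set" where
  "quarter_phases \<equiv> {1, -1, \<i>, -\<i>}"

lemma less_2_all: "(\<forall>i<2::nat. P i) \<longleftrightarrow> P 0 \<and> P (Suc 0)"
  by (auto simp: numeral_2_eq_2 All_less_Suc)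

lemma less_4_cases: "(a::nat) < 4 \<Longrightarrow> a = 0 \<or> a = 1 \<or> a = 2 \<or> a = 3"
  by auto

lemma pauli1_prod_pauli:
  assumes "a < 4" "b < 4"
  shows "\<exists>s c. s \<in> quarter_phases \<and> c < 4 \<and> (\<forall>i<2. \<forall>j<2. pauli1_prod a b i j = s * pauli1 c $$ (i,j))"
proof -
  \<comment> \<open>Two different non-identity Paulis multiply to a phase times the third one, whose
    label is \<open>6 - a - b\<close> because 1 + 2 + 3 = 6. The phase is \<open>\<i>\<close> in
    cyclic order and \<open>- \<i>\<close> otherwise.\<close>
  define c where "c = (if a = 0 then b else if b = 0 then a else if a = b then 0 else 6 - a - b)"
  define s where "s = (if a = 0 \<or> b = 0 \<or> a = b then 1
    else if (a, b) \<in> {(1,2), (2,3), (3,1)} then \<i> else - \<i>)"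
  have "s \<in> quarter_phases \<and> c < 4 \<and> (\<forall>i<2. \<forall>j<2. pauli1_prod a b i j = s * pauli1 c $$ (i,j))"
    using less_4_cases[OF assms(1)] less_4_cases[OF assms(2)]
    by (elim disjE) (simp_all add: c_def s_def less_2_all pauli1_prod_def pauli1_entry)
  then show ?thesis by blast
qed

lemma pauli1_prod_commute:
  assumes "a < 4" "b < 4"
  shows "\<exists>e\<in>{1,-1}. \<forall>i<2. \<forall>j<2. pauli1_prod b a i j = e * pauli1_prod a b i j"
  using less_4_cases[OF assms(1)] less_4_cases[OF assms(2)]
  by (elim disjE) (simp_all add: less_2_all pauli1_prod_def pauli1_entry)

lemma pauli1_prod_self:
  assumes "i < 2" "j < 2"
  shows "pauli1_prod a a i j = (if i = j then 1 else 0)"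
proof -
  have "\<forall>i<2. \<forall>j<2. pauli1_prod a a i j = (if i = j then 1 else 0)"
    by (simp add: less_2_all pauli1_prod_def pauli1_entry)
  with assms show ?thesis by blast
qed

text \<open>Orthogonality of the Paulis: the product is the identity if the labels agree and
  traceless otherwise.\<close>

lemma pauli1_prod_trace:
  assumes "a < 4" "b < 4"
  shows "pauli1_prod a b 0 0 + pauli1_prod a b 1 1 \<in> {0, 2}"
  using less_4_cases[OF assms(1)] less_4_cases[OF assms(2)]
  by (elim disjE) (simp_all add: pauli1_prod_def pauli1_entry)

lemma pauli1_hermitian:
  assumes "i < 2" "j < 2"
  shows "cnj (pauli1 a $$ (j,i)) = pauli1 a $$ (i,j)"
proof -
  have "\<forall>i<2. \<forall>j<2. cnj (pauli1 a $$ (j,i)) = pauli1 a $$ (i,j)"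
    by (simp add: less_2_all pauli1_entry)
  with assms show ?thesis by blast
qed

lemma pauli_mat_carrier [simp, intro]: "pauli_mat n p \<in> carrier_mat (2^n) (2^n)"
  by (simp add: pauli_mat_def)

lemma pauli_mat_entry:
  "r < 2^n \<Longrightarrow> c < 2^n \<Longrightarrow>
   pauli_mat n p $$ (r,c) = (\<Prod>k<n. pauli1 (p k) $$ (r div 2^k mod 2, c div 2^k mod 2))"
  by (simp add: pauli_mat_def)

lemma pauli_mat_mult_entry:
  assumes "r < 2^n" "c < 2^n"
  shows "(pauli_mat n p * pauli_mat n q) $$ (r,c)
    = (\<Prod>k<n. pauli1_prod (p k) (q k) (r div 2^k mod 2) (c div 2^k mod 2))"
proof -
  have "(pauli_mat n p * pauli_mat n q) $$ (r,c)
     = (\<Sum>x<2^n. pauli_mat n p $$ (r,x) * pauli_mat n q $$ (x,c))"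
    by (rule mat_mult_entry) (use assms in auto)
  also have "\<dots> = (\<Sum>x<2^n. \<Prod>k<n. (\<lambda>b. pauli1 (p k) $$ (r div 2^k mod 2, b) *
        pauli1 (q k) $$ (b, c div 2^k mod 2)) (x div 2^k mod 2))"
    using assms by (intro sum.cong refl) (simp add: pauli_mat_entry prod.distrib)
  also have "\<dots> = (\<Prod>k<n. pauli1_prod (p k) (q k) (r div 2^k mod 2) (c div 2^k mod 2))"
    by (subst sum_prod_bits) (simp add: pauli1_prod_def)
  finally show ?thesis .
qed

lemma prod_quarter_phases:
  "finite A \<Longrightarrow> (\<And>k. k \<in> A \<Longrightarrow> s k \<in> quarter_phases) \<Longrightarrow> prod s A \<in> quarter_phases"
proof (induction A rule: finite_induct)
  case (insert k A)
  then have "s k \<in> quarter_phases" "prod s A \<in> quarter_phases" by auto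
  then show ?case using insert(1,2) by (auto simp: algebra_simps)
qed simp

lemma pauli_mat_mult:
  assumes "is_pauli n p" "is_pauli n q"
  shows "\<exists>s r. s \<in> quarter_phases \<and> is_pauli n r \<and> pauli_mat n p * pauli_mat n q = s \<cdot>\<^sub>m pauli_mat n r"
proof -
  have "\<forall>k. k < n \<longrightarrow> (\<exists>s c. s \<in> quarter_phases \<and> c < 4 \<and>
      (\<forall>i<2. \<forall>j<2. pauli1_prod (p k) (q k) i j = s * pauli1 c $$ (i,j)))"
    using assms pauli1_prod_pauli by (simp add: is_pauli_def)
  then obtain s r where sr: "\<And>k. k < n \<Longrightarrow> s k \<in> quarter_phases \<and> r k < 4 \<and>
      (\<forall>i<2. \<forall>j<2. pauli1_prod (p k) (q k) i j = s k * pauli1 (r k) $$ (i,j))"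
    by metis
  have "pauli_mat n p * pauli_mat n q = (\<Prod>k<n. s k) \<cdot>\<^sub>m pauli_mat n r"
  proof (rule eq_matI)
    fix i j assume "i < dim_row ((\<Prod>k<n. s k) \<cdot>\<^sub>m pauli_mat n r)" "j < dim_col ((\<Prod>k<n. s k) \<cdot>\<^sub>m pauli_mat n r)"
    then have ij: "i < 2^n" "j < 2^n" by (auto simp: pauli_mat_def)
    then have "(pauli_mat n p * pauli_mat n q) $$ (i,j)
      = (\<Prod>k<n. s k * pauli1 (r k) $$ (i div 2^k mod 2, j div 2^k mod 2))"
      unfolding pauli_mat_mult_entry[OF ij] by (intro prod.cong refl) (use sr in auto)
    then show "(pauli_mat n p * pauli_mat n q) $$ (i,j) = ((\<Prod>k<n. s k) \<cdot>\<^sub>m pauli_mat n r) $$ (i,j)"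
      using ij by (simp add: pauli_mat_entry prod.distrib pauli_mat_def)
  qed (auto simp: pauli_mat_def)
  moreover have "(\<Prod>k<n. s k) \<in> quarter_phases" using sr by (intro prod_quarter_phases) auto
  moreover have "is_pauli n r" using sr by (simp add: is_pauli_def)
  ultimately show ?thesis by blast
qed

text \<open>On each qubit the factors commute or anticommute; the sign for the strings is the
  product of these signs.\<close>

lemma pauli_mat_commute:
  assumes "is_pauli n p" "is_pauli n q"
  shows "\<exists>e\<in>{1,-1}. pauli_mat n q * pauli_mat n p = e \<cdot>\<^sub>m (pauli_mat n p * pauli_mat n q)"
proof -
  have "\<forall>k. k < n \<longrightarrow> (\<exists>e\<in>{1,-1}.
      (\<forall>i<2. \<forall>j<2. pauli1_prod (q k) (p k) i j = e * pauli1_prod (p k) (q k) i j))"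
    using assms pauli1_prod_commute by (simp add: is_pauli_def)
  then obtain e where e: "\<And>k. k < n \<Longrightarrow> e k \<in> {1,-1} \<and>
      (\<forall>i<2. \<forall>j<2. pauli1_prod (q k) (p k) i j = e k * pauli1_prod (p k) (q k) i j)"
    by metis
  have "pauli_mat n q * pauli_mat n p = (\<Prod>k<n. e k) \<cdot>\<^sub>m (pauli_mat n p * pauli_mat n q)"
  proof (rule eq_matI)
    fix i j assume "i < dim_row ((\<Prod>k<n. e k) \<cdot>\<^sub>m (pauli_mat n p * pauli_mat n q))"
      "j < dim_col ((\<Prod>k<n. e k) \<cdot>\<^sub>m (pauli_mat n p * pauli_mat n q))"
    then have ij: "i < 2^n" "j < 2^n" by (auto simp: pauli_mat_def)
    then have "(pauli_mat n q * pauli_mat n p) $$ (i,j)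
      = (\<Prod>k<n. e k * pauli1_prod (p k) (q k) (i div 2^k mod 2) (j div 2^k mod 2))"
      unfolding pauli_mat_mult_entry[OF ij] by (intro prod.cong refl) (use e in auto)
    also have "\<dots> = (\<Prod>k<n. e k) * (pauli_mat n p * pauli_mat n q) $$ (i,j)"
      unfolding pauli_mat_mult_entry[OF ij] by (rule prod.distrib)
    also have "\<dots> = ((\<Prod>k<n. e k) \<cdot>\<^sub>m (pauli_mat n p * pauli_mat n q)) $$ (i,j)"
      by (subst index_smult_mat) (use ij in \<open>auto simp: pauli_mat_def\<close>)
    finally show "(pauli_mat n q * pauli_mat n p) $$ (i,j)
      = ((\<Prod>k<n. e k) \<cdot>\<^sub>m (pauli_mat n p * pauli_mat n q)) $$ (i,j)" .
  qed (auto simp: pauli_mat_def)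
  moreover have "(\<Prod>k\<in>A. e k) \<in> {1,-1}" if "finite A" "A \<subseteq> {..<n}" for A
    using that
  proof (induction A rule: finite_induct)
    case (insert k A)
    then have "e k \<in> {1,-1}" "prod e A \<in> {1,-1}" using e by auto
    then show ?case using insert(1,2) by auto
  qed simp
  ultimately show ?thesis by blast
qed

lemma pauli_mat_square: "pauli_mat n p * pauli_mat n p = 1\<^sub>m (2^n)"
proof (rule eq_matI)
  fix i j assume "i < dim_row (1\<^sub>m (2^n) :: complex mat)" "j < dim_col (1\<^sub>m (2^n) :: complex mat)"
  then have ij: "i < 2^n" "j < 2^n" by auto
  have "(pauli_mat n p * pauli_mat n p) $$ (i,j)
    = (\<Prod>k<n. if i div 2^k mod 2 = j div 2^k mod 2 then 1 else 0)"
    unfolding pauli_mat_mult_entry[OF ij] by (intro prod.cong refl pauli1_prod_self) auto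
  also have "\<dots> = (if i = j then 1 else 0)"
    using bits_eqI[OF ij] by (auto simp: prod_zero_iff)
  finally show "(pauli_mat n p * pauli_mat n p) $$ (i,j) = 1\<^sub>m (2^n) $$ (i,j)"
    using ij by simp
qed (auto simp: pauli_mat_def)

lemma pauli_mat_hermitian: "dagger (pauli_mat n p) = pauli_mat n p"
proof (rule eq_matI)
  fix i j assume "i < dim_row (pauli_mat n p)" "j < dim_col (pauli_mat n p)"
  then have ij: "i < 2^n" "j < 2^n" by (auto simp: pauli_mat_def)
  show "dagger (pauli_mat n p) $$ (i,j) = pauli_mat n p $$ (i,j)"
    using ij by (simp add: dagger_entry[OF pauli_mat_carrier] pauli_mat_entry pauli1_hermitian)
qed (auto simp: pauli_mat_def dagger_def)

text \<open>The trace factorises into single-qubit traces, each 0 or 2, so one mismatched qubit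
  makes it vanish.\<close>

lemma pauli_mat_trace:
  assumes "is_pauli n p" "is_pauli n q"
  shows "mtrace (pauli_mat n p * pauli_mat n q) \<in> {0, 2^n}"
proof -
  let ?t = "\<lambda>k. pauli1_prod (p k) (q k) 0 0 + pauli1_prod (p k) (q k) 1 1"
  have "mtrace (pauli_mat n p * pauli_mat n q) = (\<Sum>r<2^n. (pauli_mat n p * pauli_mat n q) $$ (r,r))"
    by (simp add: mtrace_def pauli_mat_def)
  also have "\<dots> = (\<Sum>r<2^n. \<Prod>k<n. (\<lambda>b. pauli1_prod (p k) (q k) b b) (r div 2^k mod 2))"
    by (intro sum.cong refl) (simp only: pauli_mat_mult_entry lessThan_iff)
  also have "\<dots> = (\<Prod>k<n. ?t k)" by (rule sum_prod_bits)
  finally have *: "mtrace (pauli_mat n p * pauli_mat n q) = (\<Prod>k<n. ?t k)" .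
  have t: "?t k \<in> {0,2}" if "k < n" for k
    using assms that pauli1_prod_trace by (simp add: is_pauli_def)
  show ?thesis
  proof (cases "\<exists>k<n. ?t k = 0")
    case True
    then have "(\<Prod>k<n. ?t k) = 0" by (intro prod_zero) auto
    then show ?thesis using * by simp
  next
    case False
    then have "(\<Prod>k<n. ?t k) = (\<Prod>k<n. 2)" using t by (intro prod.cong refl) auto
    then show ?thesis using * by simp
  qed
qed

section \<open>Unitary matrices and Pauli rotations\<close>

lemma unitary_mat_carrier: "unitary_mat d U \<Longrightarrow> U \<in> carrier_mat d d"
  by (simp add: unitary_mat_def)

lemma unitary_mat_mult:
  assumes "unitary_mat d U" "unitary_mat d V"
  shows "unitary_mat d (U * V)"
proof -
  have c: "U \<in> carrier_mat d d" "V \<in> carrier_mat d d" using assms by (auto simp: unitary_mat_def)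
  note [simp] = mult_carrier_mat[of _ d d _ d]
  have "U * V * dagger (U * V) = U * (V * dagger V) * dagger U"
    using c by (simp add: dagger_mult[OF c] assoc_mult_mat[where n\<^sub>1=d and n\<^sub>2=d and n\<^sub>3=d and n\<^sub>4=d])
  moreover have "dagger (U * V) * (U * V) = dagger V * (dagger U * U) * V"
    using c by (simp add: dagger_mult[OF c] assoc_mult_mat[where n\<^sub>1=d and n\<^sub>2=d and n\<^sub>3=d and n\<^sub>4=d])
  ultimately show ?thesis
    using assms c right_mult_one_mat[OF dagger_carrier[OF c(2)]] right_mult_one_mat[OF c(1)]
    by (simp add: unitary_mat_def)
qed

lemma unitary_mat_dagger:
  assumes "unitary_mat d U"
  shows "unitary_mat d (dagger U)"
proof -
  have "U \<in> carrier_mat d d" using assms by (simp add: unitary_mat_def)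
  then have "dagger (dagger U) = U" by (intro eq_matI) (auto simp: dagger_def)
  with assms show ?thesis by (auto simp: unitary_mat_def)
qed

lemma unitary_mat_pauli: "unitary_mat (2^n) (pauli_mat n p)"
  by (simp add: unitary_mat_def pauli_mat_hermitian pauli_mat_square)

text \<open>Each row of a unitary matrix has Euclidean norm 1.\<close>

lemma unitary_mat_entry_le_1:
  assumes U: "unitary_mat d U" and ij: "i < d" "j < d"
  shows "cmod (U $$ (i,j)) \<le> 1"
proof -
  have c: "U \<in> carrier_mat d d" using U by (simp add: unitary_mat_def)
  have "1 = (U * dagger U) $$ (i,i)" using U ij by (simp add: unitary_mat_def)
  also have "\<dots> = (\<Sum>k<d. U $$ (i,k) * dagger U $$ (k,i))"
    by (rule mat_mult_entry) (use c ij in auto)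
  also have "\<dots> = (\<Sum>k<d. complex_of_real ((cmod (U $$ (i,k)))\<^sup>2))"
    using c ij by (intro sum.cong refl) (simp add: dagger_entry flip: complex_norm_square)
  finally have "complex_of_real (\<Sum>k<d. (cmod (U $$ (i,k)))\<^sup>2) = complex_of_real 1"
    by simp
  then have "(\<Sum>k<d. (cmod (U $$ (i,k)))\<^sup>2) = 1" using of_real_eq_iff by blast
  moreover have "(cmod (U $$ (i,j)))\<^sup>2 \<le> (\<Sum>k<d. (cmod (U $$ (i,k)))\<^sup>2)"
    by (rule member_le_sum) (use ij in auto)
  ultimately show ?thesis using power2_le_imp_le[of "cmod (U $$ (i,j))" 1] by simp
qed

lemma pauli_rot_carrier [simp, intro]: "pauli_rot n Q t \<in> carrier_mat (2^n) (2^n)"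
  by (simp add: pauli_rot_def)

lemma dagger_pauli_rot: "dagger (pauli_rot n Q t) = pauli_rot n Q (- t)"
proof (rule eq_matI)
  fix i j assume "i < dim_row (pauli_rot n Q (- t))" "j < dim_col (pauli_rot n Q (- t))"
  then have ij: "i < 2^n" "j < 2^n" by (auto simp: pauli_rot_def pauli_mat_def)
  have "cnj (pauli_mat n Q $$ (j,i)) = pauli_mat n Q $$ (i,j)"
    using pauli_mat_hermitian[of n Q] dagger_entry[OF pauli_mat_carrier ij, of Q] by simp
  moreover have "dim_row (pauli_mat n Q) = 2^n" "dim_col (pauli_mat n Q) = 2^n"
    by (auto simp: pauli_mat_def)
  ultimately show "dagger (pauli_rot n Q t) $$ (i,j) = pauli_rot n Q (- t) $$ (i,j)"
    using ij by (simp add: dagger_entry[OF pauli_rot_carrier]) (simp add: pauli_rot_def)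
qed (auto simp: pauli_rot_def pauli_mat_def dagger_def)

text \<open>Source of the dependence on \<open>cos t\<close> and \<open>sin t\<close>: the
  double-angle formulas turn quadratic monomials in the half angle into these. The coefficients are
  the parts of \<open>M\<close> commuting and anticommuting with \<open>Q'\<close>, and
  \<open>\<i>/2\<close> times the commutator.\<close>

lemma pauli_rot_conj:
  assumes M: "M \<in> carrier_mat (2^n) (2^n)" and Q'_def: "Q' = pauli_mat n Q"
  shows "pauli_rot n Q t * M * pauli_rot n Q (- t)
    = (1/2) \<cdot>\<^sub>m (M + Q' * M * Q') + complex_of_real (cos t) \<cdot>\<^sub>m ((1/2) \<cdot>\<^sub>m (M + (-1) \<cdot>\<^sub>m (Q' * M * Q')))
      + complex_of_real (sin t) \<cdot>\<^sub>m ((\<i>/2) \<cdot>\<^sub>m (M * Q' + (-1) \<cdot>\<^sub>m (Q' * M)))"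
proof -
  have Q: "Q' \<in> carrier_mat (2^n) (2^n)" by (simp add: Q'_def)
  define Y where "Y = Q' * M"
  define X where "X = Y * Q'"
  define Z where "Z = M * Q'"
  have c: "X \<in> carrier_mat (2^n) (2^n)" "Y \<in> carrier_mat (2^n) (2^n)" "Z \<in> carrier_mat (2^n) (2^n)"
    using M Q by (auto simp: X_def Y_def Z_def)
  have cos_t: "cos t = 2 * (cos (t/2))\<^sup>2 - 1" and sin_t: "sin t = 2 * sin (t/2) * cos (t/2)"
    and s2: "(sin (t/2))\<^sup>2 = 1 - (cos (t/2))\<^sup>2"
    using cos_double_cos[of "t/2"] sin_double[of "t/2"] by (simp_all add: sin_squared_eq)
  define u where "u = complex_of_real (cos (t/2))"
  define w where "w = complex_of_real (sin (t/2))"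
  have ct: "complex_of_real (cos t) = 2 * u * u - 1" and st: "complex_of_real (sin t) = 2 * w * u"
    by (simp_all add: cos_t sin_t u_def w_def power2_eq_square)
  have ww: "w * w = 1 - u * u"
    using s2 unfolding u_def w_def power2_eq_square by (metis of_real_1 of_real_diff of_real_mult)
  have r: "pauli_rot n Q t = u \<cdot>\<^sub>m 1\<^sub>m (2^n) + (- \<i> * w) \<cdot>\<^sub>m Q'"
    "pauli_rot n Q (- t) = u \<cdot>\<^sub>m 1\<^sub>m (2^n) + (\<i> * w) \<cdot>\<^sub>m Q'"
    by (simp_all add: pauli_rot_def u_def w_def Q'_def)
  \<comment> \<open>The matrix identity read entrywise: \<open>x\<close>, \<open>z\<close>,
    \<open>y\<close>, \<open>v\<close> stand for entries of \<open>M\<close>, \<open>M * Q'\<close>,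
    \<open>Q' * M\<close> and \<open>Q' * M * Q'\<close>.\<close>
  have e: "u * u * x + u * (\<i> * w) * z + - \<i> * w * u * y + - \<i> * w * (\<i> * w) * v
     = 1/2 * (x + v) + (2 * u * u - 1) * (1/2 * (x + - 1 * v)) + 2 * w * u * (\<i>/2 * (z + - 1 * y))" for x y z v
  proof -
    have "- \<i> * w * (\<i> * w) * v = (w * w) * v" by (simp add: algebra_simps)
    then have *: "- \<i> * w * (\<i> * w) * v = (1 - u * u) * v" by (simp only: ww)
    show ?thesis unfolding * by (simp add: field_simps)
  qed
  show ?thesis
    unfolding r affine_sandwich[OF Q M] ct st Y_def[symmetric] X_def[symmetric] Z_def[symmetric]
    by (rule eq_matI) (use M c e in auto)
qed

text \<open>The conjugation formula collapses when the conjugated matrix is the identity: the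
  commutator vanishes and the Pauli string squares to the identity.\<close>

lemma unitary_mat_pauli_rot: "unitary_mat (2^n) (pauli_rot n Q t)"
proof -
  have "pauli_rot n Q t * pauli_rot n Q (- t) = 1\<^sub>m (2^n)" for t
  proof -
    have "pauli_rot n Q t * pauli_rot n Q (- t) = pauli_rot n Q t * 1\<^sub>m (2^n) * pauli_rot n Q (- t)"
      by (simp add: right_mult_one_mat[OF pauli_rot_carrier])
    also have "\<dots> = 1\<^sub>m (2^n)"
      unfolding pauli_rot_conj[OF one_carrier_mat refl] right_mult_one_mat[OF pauli_mat_carrier]
        left_mult_one_mat[OF pauli_mat_carrier] pauli_mat_square
      by (rule eq_matI) (auto simp: carrier_matD[OF pauli_mat_carrier])
    finally show ?thesis .
  qed
  from this[of t] this[of "- t"] show ?thesis by (simp add: unitary_mat_def dagger_pauli_rot)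
qed

section \<open>Clifford gates and Clifford angles\<close>

lemma clifford_mult:
  assumes U: "clifford n U" and V: "clifford n V"
  shows "clifford n (U * V)"
proof -
  have cU: "U \<in> carrier_mat (2^n) (2^n)" and cV: "V \<in> carrier_mat (2^n) (2^n)"
    using assms by (auto simp: clifford_def unitary_mat_def)
  note [simp] = mult_carrier_mat[of _ "2^n" "2^n" _ "2^n"]
  have "\<exists>q s. is_pauli n q \<and> s \<in> quarter_phases \<and>
      U * V * pauli_mat n p * dagger (U * V) = s \<cdot>\<^sub>m pauli_mat n q" if p: "is_pauli n p" for p
  proof -
    obtain q s where q: "is_pauli n q" "s \<in> quarter_phases"
      "V * pauli_mat n p * dagger V = s \<cdot>\<^sub>m pauli_mat n q"
      using V p unfolding clifford_def by blast
    obtain r u where r: "is_pauli n r" "u \<in> quarter_phases"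
      "U * pauli_mat n q * dagger U = u \<cdot>\<^sub>m pauli_mat n r"
      using U q(1) unfolding clifford_def by blast
    have "U * V * pauli_mat n p * dagger (U * V) = U * (V * pauli_mat n p * dagger V) * dagger U"
      using cU cV by (simp add: dagger_mult[OF cU cV]
        assoc_mult_mat[where n\<^sub>1="2^n" and n\<^sub>2="2^n" and n\<^sub>3="2^n" and n\<^sub>4="2^n"])
    also have "\<dots> = s \<cdot>\<^sub>m (U * pauli_mat n q * dagger U)"
      unfolding q(3) using cU
      by (simp add: mult_smult_distrib[where nr="2^n" and n="2^n" and nc="2^n"]
        mult_smult_assoc_mat[where nr="2^n" and n="2^n" and nc="2^n"] del: assoc_mult_mat)
    also have "\<dots> = (s * u) \<cdot>\<^sub>m pauli_mat n r"
      unfolding r(3) by (rule eq_matI) (auto simp: mult.assoc)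
    finally have "U * V * pauli_mat n p * dagger (U * V) = (s * u) \<cdot>\<^sub>m pauli_mat n r" .
    moreover have "s * u \<in> quarter_phases" using q(2) r(2) by auto
    ultimately show ?thesis using r(1) by blast
  qed
  moreover have "unitary_mat (2^n) (U * V)"
    using assms by (intro unitary_mat_mult) (auto simp: clifford_def)
  ultimately show ?thesis by (simp only: clifford_def) blast
qed

lemma clifford_one: "clifford n (1\<^sub>m (2^n))"
proof -
  have "1\<^sub>m (2^n) * pauli_mat n p * dagger (1\<^sub>m (2^n)) = 1 \<cdot>\<^sub>m pauli_mat n p" for p
    by (rule eq_matI) (auto simp: dagger_one left_mult_one_mat[OF pauli_mat_carrier]
      right_mult_one_mat[OF pauli_mat_carrier])
  moreover have "unitary_mat (2^n) (1\<^sub>m (2^n))" by (simp add: unitary_mat_def dagger_one)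
  ultimately show ?thesis unfolding clifford_def by blast
qed

text \<open>A string \<open>P\<close> commuting with \<open>Q\<close> is left alone; an
  anticommuting one becomes \<open>cos t\<close> times itself plus \<open>\<i> * sin t\<close> times
  the product of \<open>P\<close> and \<open>Q\<close>, and only one of the two terms survives. The
  condition on \<open>t\<close> is invariant under quarter shifts, unlike membership in
  \<open>clifford_angles\<close>.\<close>

lemma clifford_pauli_rot:
  assumes Q: "is_pauli n Q" and t: "cos t = 0 \<or> sin t = 0"
  shows "clifford n (pauli_rot n Q t)"
proof -
  have t': "(sin t = 0 \<and> cos t \<in> {1,-1}) \<or> (cos t = 0 \<and> sin t \<in> {1,-1})"
    using t
  proof
    assume "cos t = 0"
    then show ?thesis using sin_cos_squared_add[of t] power2_eq_1_iff[of "sin t"] by auto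
  next
    assume "sin t = 0"
    then show ?thesis using sin_cos_squared_add[of t] power2_eq_1_iff[of "cos t"] by auto
  qed
  have "\<exists>q s. is_pauli n q \<and> s \<in> quarter_phases \<and>
      pauli_rot n Q t * pauli_mat n p * dagger (pauli_rot n Q t) = s \<cdot>\<^sub>m pauli_mat n q"
    if p: "is_pauli n p" for p
  proof -
    define P where "P = pauli_mat n p"
    define R where "R = pauli_mat n Q"
    have c: "P \<in> carrier_mat (2^n) (2^n)" "R \<in> carrier_mat (2^n) (2^n)" by (simp_all add: P_def R_def)
    note [simp] = mult_carrier_mat[of _ "2^n" "2^n" _ "2^n"]
    obtain w r where wr: "w \<in> quarter_phases" "is_pauli n r" "P * R = w \<cdot>\<^sub>m pauli_mat n r"
      using pauli_mat_mult[OF p Q] unfolding P_def R_def by blast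
    obtain e where e: "e \<in> {1,-1}" "R * P = e \<cdot>\<^sub>m (P * R)"
      using pauli_mat_commute[OF p Q] unfolding P_def R_def by blast
    have "R * P * R = e \<cdot>\<^sub>m (P * (R * R))"
      unfolding e(2) using c
      by (simp add: mult_smult_assoc_mat[where nr="2^n" and n="2^n" and nc="2^n"])
    then have RPR: "R * P * R = e \<cdot>\<^sub>m P"
      using c by (simp add: R_def pauli_mat_square)
    have cS: "pauli_mat n r \<in> carrier_mat (2^n) (2^n)" by simp
    have conj: "pauli_rot n Q t * P * dagger (pauli_rot n Q t)
      = (1/2) \<cdot>\<^sub>m (P + e \<cdot>\<^sub>m P) + complex_of_real (cos t) \<cdot>\<^sub>m ((1/2) \<cdot>\<^sub>m (P + (-1) \<cdot>\<^sub>m (e \<cdot>\<^sub>m P)))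
      + complex_of_real (sin t) \<cdot>\<^sub>m ((\<i>/2) \<cdot>\<^sub>m (w \<cdot>\<^sub>m pauli_mat n r + (-1) \<cdot>\<^sub>m (e \<cdot>\<^sub>m (w \<cdot>\<^sub>m pauli_mat n r))))"
      by (simp only: dagger_pauli_rot pauli_rot_conj[OF c(1) R_def] RPR) (simp only: e(2) wr(3))
    consider "e = 1" | "e = -1" "sin t = 0" "cos t \<in> {1,-1}" | "e = -1" "cos t = 0" "sin t \<in> {1,-1}"
      using e(1) t' by blast
    then show ?thesis
    proof cases
      case 1
      have "pauli_rot n Q t * P * dagger (pauli_rot n Q t) = 1 \<cdot>\<^sub>m P"
        unfolding conj 1 by (rule eq_matI) (use c in \<open>auto simp: carrier_matD[OF cS]\<close>)
      then show ?thesis using p unfolding P_def by blast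
    next
      case 2
      have "pauli_rot n Q t * P * dagger (pauli_rot n Q t) = complex_of_real (cos t) \<cdot>\<^sub>m P"
        unfolding conj 2 by (rule eq_matI) (use c in \<open>auto simp: carrier_matD[OF cS]\<close>)
      moreover have "complex_of_real (cos t) \<in> quarter_phases" using 2(3) by auto
      ultimately show ?thesis using p unfolding P_def by blast
    next
      case 3
      have "pauli_rot n Q t * P * dagger (pauli_rot n Q t)
          = (complex_of_real (sin t) * \<i> * w) \<cdot>\<^sub>m pauli_mat n r"
        unfolding conj 3 by (rule eq_matI) (use c in \<open>auto simp: carrier_matD[OF cS]\<close>)
      moreover have "complex_of_real (sin t) * \<i> * w \<in> quarter_phases" using 3(3) wr(1) by auto
      ultimately show ?thesis using wr(2) unfolding P_def by blast
    qed
  qed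
  then show ?thesis unfolding clifford_def using unitary_mat_pauli_rot by blast
qed

section \<open>Circuits and expectation values\<close>

lemma circuit_mat_append:
  "circuit_mat n (gs @ [g]) \<phi> = gate_mat n \<phi> g * circuit_mat n gs \<phi>"
  by (simp add: circuit_mat_def)

lemma circuit_mat_Nil [simp]: "circuit_mat n [] \<phi> = 1\<^sub>m (2^n)"
  by (simp add: circuit_mat_def)

lemma unitary_mat_circuit:
  assumes "\<forall>g\<in>set gs. valid_gate n m g"
  shows "unitary_mat (2^n) (circuit_mat n gs \<phi>)"
  using assms
proof (induction gs rule: rev_induct)
  case Nil
  show ?case using clifford_one by (simp add: clifford_def)
next
  case (snoc g gs)
  have "unitary_mat (2^n) (gate_mat n \<phi> g)"
    using snoc.prems by (cases g) (auto simp: valid_gate_def clifford_def unitary_mat_pauli_rot)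
  with snoc show ?case unfolding circuit_mat_append by (intro unitary_mat_mult) auto
qed

lemma clifford_circuit_mat:
  assumes "\<forall>g\<in>set gs. valid_gate n m g" "\<And>k. k < m \<Longrightarrow> cos (\<phi> k) = 0 \<or> sin (\<phi> k) = 0"
  shows "clifford n (circuit_mat n gs \<phi>)"
  using assms(1)
proof (induction gs rule: rev_induct)
  case Nil
  show ?case by (simp add: clifford_one)
next
  case (snoc g gs)
  have "clifford n (gate_mat n \<phi> g)"
    using snoc.prems assms(2) by (cases g) (auto simp: valid_gate_def clifford_pauli_rot)
  with snoc show ?case unfolding circuit_mat_append by (intro clifford_mult) auto
qed

text \<open>Heisenberg picture: the last gate conjugates the observable first, so the induction runs
  from the end of the list. \<open>M\<close> is arbitrary because a conjugated Pauli string need not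
  be one. A rotation adds one angle, fresh because no angle occurs twice.\<close>

lemma multi_trig_circuit:
  assumes "\<forall>g\<in>set gs. valid_gate n m g"
    and "\<forall>k. length (filter (\<lambda>g. rot_index g = Some k) gs) \<le> 1"
    and "\<rho> \<in> carrier_mat (2^n) (2^n)" and "M \<in> carrier_mat (2^n) (2^n)"
  shows "multi_trig {k. Some k \<in> rot_index ` set gs}
    (\<lambda>\<phi>. Re (mtrace (\<rho> * dagger (circuit_mat n gs \<phi>) * M * circuit_mat n gs \<phi>)))"
  using assms(1,2,4)
proof (induction gs arbitrary: M rule: rev_induct)
  case Nil
  show ?case by (simp add: multi_trig_const)
next
  case (snoc g gs)
  let ?U = "circuit_mat n gs"
  let ?T = "\<lambda>M \<phi>. Re (mtrace (\<rho> * dagger (?U \<phi>) * M * ?U \<phi>))"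
  note [simp] = mult_carrier_mat[of _ "2^n" "2^n" _ "2^n"]
  have cU: "?U \<phi> \<in> carrier_mat (2^n) (2^n)" for \<phi>
    using unitary_mat_circuit snoc.prems(1) by (intro unitary_mat_carrier) auto
  have le: "\<forall>k. length (filter (\<lambda>g. rot_index g = Some k) gs) \<le> 1"
    using snoc.prems(2) by (metis (no_types, lifting) filter_append le_add1 length_append order_trans)
  have IH: "multi_trig {k. Some k \<in> rot_index ` set gs} (?T M)"
    if "M \<in> carrier_mat (2^n) (2^n)" for M
    using snoc.IH[OF _ le that] snoc.prems(1) by simp
  have conj: "\<rho> * dagger (circuit_mat n (gs @ [g]) \<phi>) * M * circuit_mat n (gs @ [g]) \<phi>
    = \<rho> * dagger (?U \<phi>) * (dagger G * M * G) * ?U \<phi>"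
    if G: "G = gate_mat n \<phi> g" "G \<in> carrier_mat (2^n) (2^n)" for G \<phi>
    unfolding circuit_mat_append G(1)[symmetric] dagger_mult[OF G(2) cU]
    using cU[of \<phi>] G(2) assms(3) snoc.prems(3)
    by (simp add: assoc_mult_mat[where n\<^sub>1="2^n" and n\<^sub>2="2^n" and n\<^sub>3="2^n" and n\<^sub>4="2^n"])
  show ?case
  proof (cases g)
    case (Cliff G)
    then have G: "G \<in> carrier_mat (2^n) (2^n)"
      using snoc.prems(1) by (auto simp: valid_gate_def clifford_def unitary_mat_def)
    have "(\<lambda>\<phi>. Re (mtrace (\<rho> * dagger (circuit_mat n (gs @ [g]) \<phi>) * M * circuit_mat n (gs @ [g]) \<phi>)))
       = ?T (dagger G * M * G)"
      using conj[of G] G Cliff by (intro ext) simp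
    moreover have "{k. Some k \<in> rot_index ` set (gs @ [g])} = {k. Some k \<in> rot_index ` set gs}"
      using Cliff by auto
    ultimately show ?thesis using IH[of "dagger G * M * G"] G snoc.prems(3) by simp
  next
    case (Rot Q k)
    define Q' where "Q' = pauli_mat n Q"
    have cQ: "Q' \<in> carrier_mat (2^n) (2^n)" by (simp add: Q'_def)
    define M0 where "M0 = (1/2) \<cdot>\<^sub>m (M + Q' * M * Q')"
    define M1 where "M1 = (1/2) \<cdot>\<^sub>m (M + (-1) \<cdot>\<^sub>m (Q' * M * Q'))"
    define M2 where "M2 = (\<i>/2) \<cdot>\<^sub>m (M * Q' + (-1) \<cdot>\<^sub>m (Q' * M))"
    \<comment> \<open>The adjoint stands on the left, so the observable is conjugated by the
      rotation through the negative angle and the sine coefficient changes sign.\<close>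
    define M2' where "M2' = (-1) \<cdot>\<^sub>m M2"
    have cM: "M0 \<in> carrier_mat (2^n) (2^n)" "M1 \<in> carrier_mat (2^n) (2^n)" "M2 \<in> carrier_mat (2^n) (2^n)"
       "M2' \<in> carrier_mat (2^n) (2^n)"
      using cQ snoc.prems(3) by (auto simp: M0_def M1_def M2_def M2'_def)
    have k: "k \<notin> {k. Some k \<in> rot_index ` set gs}"
    proof
      assume "k \<in> {k. Some k \<in> rot_index ` set gs}"
      then obtain h where "h \<in> set gs" "rot_index h = Some k" by auto
      then have "filter (\<lambda>g. rot_index g = Some k) gs \<noteq> []" by (auto simp: filter_empty_conv)
      then have "length (filter (\<lambda>g. rot_index g = Some k) gs) \<ge> 1"
        by (simp add: Suc_leI)
      moreover have "length (filter (\<lambda>g. rot_index g = Some k) (gs @ [g])) \<le> 1"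
        using snoc.prems(2) by blast
      ultimately show False using Rot by simp
    qed
    have "Re (mtrace (\<rho> * dagger (circuit_mat n (gs @ [g]) \<phi>) * M * circuit_mat n (gs @ [g]) \<phi>))
       = ?T M0 \<phi> + cos (\<phi> k) * ?T M1 \<phi> + sin (\<phi> k) * ?T M2' \<phi>" for \<phi>
    proof -
      have "dagger (pauli_rot n Q (\<phi> k)) * M * pauli_rot n Q (\<phi> k)
         = M0 + complex_of_real (cos (\<phi> k)) \<cdot>\<^sub>m M1 + complex_of_real (sin (- \<phi> k)) \<cdot>\<^sub>m M2"
        using pauli_rot_conj[OF snoc.prems(3) Q'_def, of "- \<phi> k"]
        by (simp add: dagger_pauli_rot M0_def M1_def M2_def)
      also have "\<dots> = M0 + complex_of_real (cos (\<phi> k)) \<cdot>\<^sub>m M1 + complex_of_real (sin (\<phi> k)) \<cdot>\<^sub>m M2'"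
        unfolding M2'_def by (rule eq_matI) (use cM in auto)
      finally have *: "\<rho> * dagger (circuit_mat n (gs @ [g]) \<phi>) * M * circuit_mat n (gs @ [g]) \<phi>
        = \<rho> * dagger (?U \<phi>) * (M0 + complex_of_real (cos (\<phi> k)) \<cdot>\<^sub>m M1 + complex_of_real (sin (\<phi> k)) \<cdot>\<^sub>m M2') * ?U \<phi>"
        using conj[of "pauli_rot n Q (\<phi> k)" \<phi>] Rot by simp
      have c: "\<rho> * dagger (?U \<phi>) \<in> carrier_mat (2^n) (2^n)"
        using cU[of \<phi>] assms(3) by auto
      have c': "\<rho> * dagger (?U \<phi>) * X * ?U \<phi> \<in> carrier_mat (2^n) (2^n)"
        if "X \<in> carrier_mat (2^n) (2^n)" for X
        using mult_carrier_mat[OF mult_carrier_mat[OF c that] cU] .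
      show ?thesis
        unfolding * mult_lincomb_mult[OF c cU cM(1,2,4)]
          mtrace_add_smult[OF c'[OF cM(1)] c'[OF cM(2)] c'[OF cM(4)]] by simp
    qed
    moreover have "{k. Some k \<in> rot_index ` set (gs @ [g])} = insert k {k. Some k \<in> rot_index ` set gs}"
      using Rot by auto
    ultimately show ?thesis
      using multi_trig.step[OF k IH[OF cM(1)] IH[OF cM(2)] IH[OF cM(4)]] by presburger
  qed
qed

lemma stabilizer_state_carrier: "stabilizer_state n \<rho> \<Longrightarrow> \<rho> \<in> carrier_mat (2^n) (2^n)"
  by (auto simp: stabilizer_state_def Let_def)

lemma multi_trig_ell:
  assumes "stabilizer_state n \<rho>" and gs: "clifford_circuit n m gs"
  shows "multi_trig {..<m} (ell n \<rho> gs P)"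
proof -
  have valid: "\<forall>g\<in>set gs. valid_gate n m g"
    and once: "\<And>k. k < m \<Longrightarrow> length (filter (\<lambda>g. rot_index g = Some k) gs) = 1"
    using gs by (auto simp: clifford_circuit_def)
  have lt: "k < m" if "g \<in> set gs" "rot_index g = Some k" for g k
    using valid that by (cases g) (auto simp: valid_gate_def)
  have "length (filter (\<lambda>g. rot_index g = Some k) gs) \<le> 1" for k
  proof (cases "k < m")
    case False
    then have "filter (\<lambda>g. rot_index g = Some k) gs = []" using lt by (auto simp: filter_empty_conv)
    then show ?thesis by simp
  qed (use once in simp)
  moreover have "{k. Some k \<in> rot_index ` set gs} = {..<m}"
  proof (intro equalityI subsetI)
    fix k assume "k \<in> {..<m}"
    then have "filter (\<lambda>g. rot_index g = Some k) gs \<noteq> []" using once[of k] by auto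
    then show "k \<in> {k. Some k \<in> rot_index ` set gs}"
      by (auto simp: filter_empty_conv) (metis image_eqI)
  qed (use lt in \<open>auto simp: eq_commute\<close>)
  ultimately show ?thesis
    using multi_trig_circuit[OF valid _ stabilizer_state_carrier[OF assms(1)] pauli_mat_carrier, of P]
    by (simp add: ell_def[abs_def])
qed

text \<open>\<open>\<rho>\<close> projects onto the image of the zero basis vector under
  \<open>V\<close>, so the trace is an expectation in that vector. The initial state is thereby
  absorbed into the circuit as one more Clifford operation.\<close>

lemma ell_as_entry:
  assumes V: "clifford n V"
    and \<rho>: "\<rho> = (let \<psi> = V *\<^sub>v unit_vec (2^n) 0 in mat (2^n) (2^n) (\<lambda>(r,c). \<psi> $ r * cnj (\<psi> $ c)))"
    and gs: "\<forall>g\<in>set gs. valid_gate n m g"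
  defines "W \<equiv> \<lambda>\<phi>. circuit_mat n gs \<phi> * V"
  shows "ell n \<rho> gs P \<phi> = Re ((dagger (W \<phi>) * pauli_mat n P * W \<phi>) $$ (0,0))"
proof -
  let ?d = "2^n :: nat"
  define U where "U = circuit_mat n gs \<phi>"
  note [simp] = mult_carrier_mat[of _ "2^n" "2^n" _ "2^n"]
  have cV: "V \<in> carrier_mat ?d ?d" using V by (simp add: clifford_def unitary_mat_def)
  have cU: "U \<in> carrier_mat ?d ?d"
    unfolding U_def using unitary_mat_circuit[OF gs] by (rule unitary_mat_carrier)
  have c\<rho>: "\<rho> \<in> carrier_mat ?d ?d" unfolding \<rho> by (simp add: Let_def)
  define A where "A = dagger U * pauli_mat n P * U"
  have cA: "A \<in> carrier_mat ?d ?d" using cU by (auto simp: A_def)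
  have psi: "(V *\<^sub>v unit_vec ?d 0) $ r = V $$ (r,0)" if "r < ?d" for r
    using cV that by (simp add: scalar_prod_right_unit)
  have \<rho>e: "\<rho> $$ (r,c) = V $$ (r,0) * cnj (V $$ (c,0))" if "r < ?d" "c < ?d" for r c
    using that psi unfolding \<rho> Let_def by simp
  have "\<rho> * dagger U * pauli_mat n P * U = \<rho> * A"
    unfolding A_def using cU c\<rho>
    by (simp add: assoc_mult_mat[where n\<^sub>1="2^n" and n\<^sub>2="2^n" and n\<^sub>3="2^n" and n\<^sub>4="2^n"])
  moreover have "mtrace (\<rho> * A) = (\<Sum>r<?d. \<Sum>c<?d. V $$ (r,0) * cnj (V $$ (c,0)) * A $$ (c,r))"
    unfolding mtrace_def using c\<rho> cA
    by (intro sum.cong) (auto simp: mat_mult_entry[OF c\<rho> cA] \<rho>e simp del: index_mult_mat(1))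
  moreover have "(dagger (U * V) * pauli_mat n P * (U * V)) = dagger V * (A * V)"
    unfolding dagger_mult[OF cU cV] A_def using cU cV
    by (simp add: assoc_mult_mat[where n\<^sub>1="2^n" and n\<^sub>2="2^n" and n\<^sub>3="2^n" and n\<^sub>4="2^n"])
  moreover have "(dagger V * (A * V)) $$ (0,0) = (\<Sum>c<?d. \<Sum>r<?d. V $$ (r,0) * cnj (V $$ (c,0)) * A $$ (c,r))"
    unfolding mat_mult_entry[OF dagger_carrier[OF cV] mult_carrier_mat[OF cA cV], of 0 0, simplified]
    by (intro sum.cong) (auto simp: mat_mult_entry[OF cA cV] dagger_entry[OF cV] sum_distrib_left mult_ac
       simp del: index_mult_mat(1))
  ultimately show ?thesis
    unfolding ell_def W_def U_def[symmetric]
    using sum.swap[of "\<lambda>r c. V $$ (r,0) * cnj (V $$ (c,0)) * A $$ (c,r)" "{..<?d}" "{..<?d}"]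
    by (simp del: index_mult_mat(1))
qed

text \<open>A Pauli string conjugated by a unitary is unitary, so its entries have modulus at most
  1. This is what makes the value \<open>- \<bar>c i\<bar>\<close> a global minimum of the term
  \<open>i\<close>.\<close>

lemma abs_ell_le_1:
  assumes \<rho>: "stabilizer_state n \<rho>" and gs: "clifford_circuit n m gs"
  shows "\<bar>ell n \<rho> gs P \<phi>\<bar> \<le> 1"
proof -
  obtain V where V: "clifford n V"
    "\<rho> = (let \<psi> = V *\<^sub>v unit_vec (2^n) 0 in mat (2^n) (2^n) (\<lambda>(r,c). \<psi> $ r * cnj (\<psi> $ c)))"
    using \<rho> unfolding stabilizer_state_def Let_def by blast
  have valid: "\<forall>g\<in>set gs. valid_gate n m g" using gs by (simp add: clifford_circuit_def)
  have "unitary_mat (2^n) (circuit_mat n gs \<phi> * V)"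
    using V(1) by (intro unitary_mat_mult unitary_mat_circuit[OF valid]) (simp add: clifford_def)
  from unitary_mat_entry_le_1[OF unitary_mat_mult[OF unitary_mat_mult[OF
      unitary_mat_dagger[OF this] unitary_mat_pauli] this], of 0 0 P] show ?thesis
    unfolding ell_as_entry[OF V valid] using abs_Re_le_cmod order_trans by fastforce
qed

text \<open>\<open>|0\<rangle>\<langle>0| = 2\<^sup>-\<^sup>n \<Sum>\<^sub>z Z\<^sub>z\<close> over all strings of \<open>I\<close> and \<open>Z\<close>, and conjugation by \<open>W\<close> turns
  each summand into a phase times a Pauli string, whose trace against \<open>P\<close> is \<open>0\<close> or \<open>2\<^sup>n\<close>.\<close>
lemma clifford_conj_entry_Ints:
  assumes W: "clifford n W" and P: "is_pauli n P"
  shows "Re ((dagger W * pauli_mat n P * W) $$ (0,0)) \<in> \<int>"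
proof -
  let ?d = "2^n :: nat"
  note [simp] = mult_carrier_mat[of _ "2^n" "2^n" _ "2^n"]
  have cW: "W \<in> carrier_mat ?d ?d" using W by (simp add: clifford_def unitary_mat_def)
  \<comment> \<open>Labels 0 and 3 are the single-qubit \<open>I\<close> and \<open>Z\<close>, whose
    sum is twice the projector onto the zero state; over all qubits this gives the factor
    \<open>2^n\<close>.\<close>
  define Z where "Z = PiE {..<n} (\<lambda>_. {0,3::nat})"
  have finZ: "finite Z" by (auto simp: Z_def intro!: finite_PiE)
  have Zp: "is_pauli n z" if "z \<in> Z" for z
    using that by (fastforce simp: Z_def is_pauli_def PiE_def Pi_def)
  have Zsum: "(\<Sum>z\<in>Z. pauli_mat n z $$ (u,v)) = (if u = 0 \<and> v = 0 then 2^n else 0)"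
    if uv: "u < ?d" "v < ?d" for u v
  proof -
    let ?b = "\<lambda>x k. x div 2^k mod 2 :: nat"
    have one: "(\<Sum>a\<in>{0,3}. pauli1 a $$ (i,j)) = (if i = 0 \<and> j = 0 then 2 else 0)"
      if "i < 2" "j < 2" for i j
    proof -
      have "\<forall>i<2. \<forall>j<2. (\<Sum>a\<in>{0,3}. pauli1 a $$ (i,j)) = (if i = 0 \<and> j = 0 then 2 else 0)"
        by (simp add: less_2_all pauli1_entry)
      with that show ?thesis by blast
    qed
    have "(\<Sum>z\<in>Z. pauli_mat n z $$ (u,v)) = (\<Sum>z\<in>Z. \<Prod>k<n. pauli1 (z k) $$ (?b u k, ?b v k))"
      using uv by (simp add: pauli_mat_entry)
    also have "\<dots> = (\<Prod>k<n. \<Sum>a\<in>{0,3}. pauli1 a $$ (?b u k, ?b v k))"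
      unfolding Z_def by (subst prod_sum_PiE) auto
    also have "\<dots> = (\<Prod>k<n. if ?b u k = 0 \<and> ?b v k = 0 then 2 else 0)"
      by (intro prod.cong refl one) auto
    also have "\<dots> = (if u = 0 \<and> v = 0 then 2^n else 0)"
    proof (cases "\<forall>k<n. ?b u k = 0 \<and> ?b v k = 0")
      case True
      then have "u = 0" "v = 0" using bits_eqI[OF uv(1), of 0] bits_eqI[OF uv(2), of 0] by auto
      then show ?thesis by simp
    next
      case False
      then have "\<not> (u = 0 \<and> v = 0)" by (metis div_0 mod_0)
      moreover have "(\<Prod>k<n. if ?b u k = 0 \<and> ?b v k = 0 then 2 else 0 :: complex) = 0"
        using False by (intro prod_zero) auto
      ultimately show ?thesis by simp
    qed
    finally show ?thesis .
  qed
  have conj: "\<exists>q s. is_pauli n q \<and> s \<in> quarter_phases \<and>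
      W * pauli_mat n z * dagger W = s \<cdot>\<^sub>m pauli_mat n q" if "z \<in> Z" for z
    using W Zp[OF that] unfolding clifford_def by blast
  have tr: "\<exists>i::int. Re (mtrace (W * pauli_mat n z * dagger W * pauli_mat n P)) = of_int i * 2^n"
    if z: "z \<in> Z" for z
  proof -
    obtain q s where q: "is_pauli n q" "s \<in> quarter_phases"
      "W * pauli_mat n z * dagger W = s \<cdot>\<^sub>m pauli_mat n q" using conj[OF z] by blast
    have "mtrace (W * pauli_mat n z * dagger W * pauli_mat n P) = s * mtrace (pauli_mat n q * pauli_mat n P)"
      unfolding q(3) mult_smult_assoc_mat[OF pauli_mat_carrier pauli_mat_carrier]
      by (auto simp: mtrace_def sum_distrib_left carrier_matD[OF pauli_mat_carrier] intro!: sum.cong)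
    \<comment> \<open>The definition of \<open>clifford\<close> allows the phases
      \<open>\<i>\<close> and \<open>- \<i>\<close>; taking real parts sends them to 0 and so keeps
      integrality.\<close>
    moreover have "Re s \<in> {0, 1, -1}" using q(2) by auto
    moreover have "mtrace (pauli_mat n q * pauli_mat n P) \<in> {0, complex_of_real (2^n)}"
      using pauli_mat_trace[OF q(1) P] by simp
    ultimately have "Re (mtrace (W * pauli_mat n z * dagger W * pauli_mat n P)) \<in> {of_int 0 * 2^n, of_int 1 * 2^n, of_int (-1) * 2^n}"
      by (auto simp del: of_real_power)
    then show ?thesis by blast
  qed
  have entry: "(W * X * dagger W) $$ (i,j) = (\<Sum>v<?d. \<Sum>u<?d. W $$ (i,u) * X $$ (u,v) * cnj (W $$ (j,v)))"
    if X: "X \<in> carrier_mat ?d ?d" and ij: "i < ?d" "j < ?d" for X i j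
    unfolding mat_mult_entry[OF mult_carrier_mat[OF cW X] dagger_carrier[OF cW] ij]
    by (intro sum.cong refl) (use ij in \<open>simp add: mat_mult_entry[OF cW X] dagger_entry[OF cW] sum_distrib_right del: index_mult_mat(1)\<close>)
  have rank1: "(\<Sum>z\<in>Z. (W * pauli_mat n z * dagger W) $$ (i,j)) = 2^n * (W $$ (i,0) * cnj (W $$ (j,0)))"
    if ij: "i < ?d" "j < ?d" for i j
  proof -
    have "(\<Sum>z\<in>Z. (W * pauli_mat n z * dagger W) $$ (i,j))
       = (\<Sum>z\<in>Z. \<Sum>v<?d. \<Sum>u<?d. W $$ (i,u) * cnj (W $$ (j,v)) * pauli_mat n z $$ (u,v))"
      by (intro sum.cong refl) (simp add: entry[OF pauli_mat_carrier ij] mult_ac del: index_mult_mat(1))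
    also have "\<dots> = (\<Sum>v<?d. \<Sum>z\<in>Z. \<Sum>u<?d. W $$ (i,u) * cnj (W $$ (j,v)) * pauli_mat n z $$ (u,v))"
      by (rule sum.swap)
    also have "\<dots> = (\<Sum>v<?d. \<Sum>u<?d. \<Sum>z\<in>Z. W $$ (i,u) * cnj (W $$ (j,v)) * pauli_mat n z $$ (u,v))"
      by (intro sum.cong refl sum.swap)
    also have "\<dots> = (\<Sum>v<?d. \<Sum>u<?d. W $$ (i,u) * cnj (W $$ (j,v)) * (if u = 0 \<and> v = 0 then 2^n else 0))"
      by (intro sum.cong refl) (simp add: Zsum flip: sum_distrib_left)
    also have "\<dots> = (\<Sum>v<?d. \<Sum>u<?d. if u = 0 then if v = 0 then W $$ (i,u) * cnj (W $$ (j,v)) * 2^n else 0 else 0)"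
      by (intro sum.cong refl) auto
    also have "\<dots> = 2^n * (W $$ (i,0) * cnj (W $$ (j,0)))"
      by simp
    finally show ?thesis .
  qed
  let ?x = "(dagger W * pauli_mat n P * W) $$ (0,0)"
  have "?x = (dagger W * (pauli_mat n P * W)) $$ (0,0)"
    using cW by (simp add: assoc_mult_mat[where n\<^sub>1="2^n" and n\<^sub>2="2^n" and n\<^sub>3="2^n" and n\<^sub>4="2^n"] del: index_mult_mat(1))
  also have "\<dots> = (\<Sum>j<?d. \<Sum>i<?d. W $$ (i,0) * cnj (W $$ (j,0)) * pauli_mat n P $$ (j,i))"
    unfolding mat_mult_entry[OF dagger_carrier[OF cW] mult_carrier_mat[OF pauli_mat_carrier cW], of 0 0, simplified]
    by (intro sum.cong) (auto simp: mat_mult_entry[OF pauli_mat_carrier cW] dagger_entry[OF cW] sum_distrib_left mult_ac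
       simp del: index_mult_mat(1))
  finally have "2^n * ?x = (\<Sum>j<?d. \<Sum>i<?d. 2^n * (W $$ (i,0) * cnj (W $$ (j,0))) * pauli_mat n P $$ (j,i))"
    by (simp add: sum_distrib_left mult_ac)
  also have "\<dots> = (\<Sum>j<?d. \<Sum>i<?d. \<Sum>z\<in>Z. (W * pauli_mat n z * dagger W) $$ (i,j) * pauli_mat n P $$ (j,i))"
    by (intro sum.cong refl) (simp add: sum_distrib_right del: index_mult_mat(1) flip: rank1)
  also have "\<dots> = (\<Sum>j<?d. \<Sum>z\<in>Z. \<Sum>i<?d. (W * pauli_mat n z * dagger W) $$ (i,j) * pauli_mat n P $$ (j,i))"
    by (intro sum.cong refl sum.swap)
  also have "\<dots> = (\<Sum>z\<in>Z. \<Sum>j<?d. \<Sum>i<?d. (W * pauli_mat n z * dagger W) $$ (i,j) * pauli_mat n P $$ (j,i))"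
    by (rule sum.swap)
  also have "\<dots> = (\<Sum>z\<in>Z. \<Sum>i<?d. \<Sum>j<?d. (W * pauli_mat n z * dagger W) $$ (i,j) * pauli_mat n P $$ (j,i))"
    by (intro sum.cong refl sum.swap)
  also have "\<dots> = (\<Sum>z\<in>Z. mtrace (W * pauli_mat n z * dagger W * pauli_mat n P))"
  proof (intro sum.cong refl)
    fix z
    have c: "W * pauli_mat n z * dagger W \<in> carrier_mat ?d ?d" using cW by auto
    show "(\<Sum>i<?d. \<Sum>j<?d. (W * pauli_mat n z * dagger W) $$ (i,j) * pauli_mat n P $$ (j,i))
      = mtrace (W * pauli_mat n z * dagger W * pauli_mat n P)"
      unfolding mtrace_def using c
      by (intro sum.cong) (auto simp: mat_mult_entry[OF c pauli_mat_carrier] simp del: index_mult_mat(1))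
  qed
  finally have "2^n * ?x = (\<Sum>z\<in>Z. mtrace (W * pauli_mat n z * dagger W * pauli_mat n P))" .
  then have "Re (complex_of_real (2^n) * ?x) = (\<Sum>z\<in>Z. Re (mtrace (W * pauli_mat n z * dagger W * pauli_mat n P)))"
    by (simp only: of_real_power of_real_numeral Re_sum)
  moreover obtain f where "\<And>z. z \<in> Z \<Longrightarrow>
      Re (mtrace (W * pauli_mat n z * dagger W * pauli_mat n P)) = of_int (f z) * 2^n"
    using tr by metis
  ultimately have "2^n * Re ?x = (\<Sum>z\<in>Z. of_int (f z) * 2^n)"
    by (simp only: Re_complex_of_real Im_complex_of_real times_complex.sel) simp
  also have "\<dots> = 2^n * of_int (\<Sum>z\<in>Z. f z)" by (simp add: sum_distrib_left mult.commute)
  finally have "Re ?x = of_int (\<Sum>z\<in>Z. f z)" by simp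
  then show ?thesis by (metis Ints_of_int)
qed

lemma ell_integer:
  assumes \<rho>: "stabilizer_state n \<rho>" and gs: "clifford_circuit n m gs" and P: "is_pauli n P"
    and \<phi>: "\<And>k. k < m \<Longrightarrow> cos (\<phi> k) = 0 \<or> sin (\<phi> k) = 0"
  shows "ell n \<rho> gs P \<phi> \<in> \<int>"
proof -
  obtain V where V: "clifford n V"
    "\<rho> = (let \<psi> = V *\<^sub>v unit_vec (2^n) 0 in mat (2^n) (2^n) (\<lambda>(r,c). \<psi> $ r * cnj (\<psi> $ c)))"
    using \<rho> unfolding stabilizer_state_def Let_def by blast
  have valid: "\<forall>g\<in>set gs. valid_gate n m g" using gs by (simp add: clifford_circuit_def)
  show ?thesis
    unfolding ell_as_entry[OF V valid]
    by (intro clifford_conj_entry_Ints clifford_mult clifford_circuit_mat[OF valid] \<phi> V(1) P)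
qed

subsection \<open>Mean squares and local minima\<close>

lemma partial_cmult:
  assumes "multi_trig K f"
  shows "partial k (\<lambda>\<phi>. a * f \<phi>) = (\<lambda>\<phi>. a * partial k f \<phi>)"
  by (rule ext, rule partial_eqI) (intro DERIV_cmult multi_trig_partial_DERIV[OF assms])

lemma partial_sum:
  assumes "\<And>j. j \<in> J \<Longrightarrow> multi_trig K (f j)"
  shows "partial k (\<lambda>\<phi>. \<Sum>j\<in>J. c j * f j \<phi>) = (\<lambda>\<phi>. \<Sum>j\<in>J. c j * partial k (f j) \<phi>)"
  by (rule ext, rule partial_eqI) (intro DERIV_sum DERIV_cmult multi_trig_partial_DERIV[OF assms])

text \<open>In the quadratic form at an eigenvector \<open>w\<close>, the part \<open>G\<close>
  contributes at least 0, and Cauchy-Schwarz bounds the part \<open>R\<close> by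
  \<open>m * \<delta>\<close> times the squared norm of \<open>w\<close>.\<close>

lemma eigenvalue_lower_bound:
  fixes G R :: "nat \<Rightarrow> nat \<Rightarrow> real" and ev :: real
  assumes ev: "eigenvalue (mat m m (\<lambda>(k,l). G k l + R k l)) ev"
    and G: "\<And>v. (\<Sum>k<m. \<Sum>l<m. v k * v l * G k l) \<ge> 0"
    and R: "\<And>k l. k < m \<Longrightarrow> l < m \<Longrightarrow> \<bar>R k l\<bar> \<le> \<delta>"
  shows "ev \<ge> - (real m * \<delta>)"
proof -
  let ?H = "mat m m (\<lambda>(k,l). G k l + R k l)"
  obtain w where w: "w \<in> carrier_vec m" "w \<noteq> 0\<^sub>v m" "?H *\<^sub>v w = ev \<cdot>\<^sub>v w"
    using ev unfolding eigenvalue_def eigenvector_def by auto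
  define x where "x k = w $ k" for k
  define S where "S = (\<Sum>k<m. (x k)\<^sup>2)"
  obtain k0 where k0: "k0 < m" "x k0 \<noteq> 0"
    using w(1,2) by (metis carrier_vecD eq_vecI index_zero_vec(1,2) x_def)
  have "0 < (x k0)\<^sup>2" using k0(2) by simp
  also have "\<dots> \<le> S" unfolding S_def by (rule member_le_sum) (use k0(1) in auto)
  finally have S: "S > 0" .
  \<comment> \<open>A nonzero eigenvector supplies an index below \<open>m\<close>, so the bound on
    \<open>R\<close> is not vacuous.\<close>
  have \<delta>: "\<delta> \<ge> 0" using R[OF k0(1) k0(1)] by linarith
  have row: "(\<Sum>l<m. (G k l + R k l) * x l) = ev * x k" if "k < m" for k
  proof -
    have "(?H *\<^sub>v w) $ k = (\<Sum>l<m. (G k l + R k l) * x l)"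
      using that w(1) by (auto simp: scalar_prod_def x_def atLeast0LessThan intro!: sum.cong)
    moreover have "(?H *\<^sub>v w) $ k = ev * x k"
      unfolding w(3) using that w(1) by (simp add: x_def)
    ultimately show ?thesis by simp
  qed
  have "ev * S = (\<Sum>k<m. x k * (ev * x k))"
    by (simp add: S_def sum_distrib_left power2_eq_square mult_ac)
  also have "\<dots> = (\<Sum>k<m. x k * (\<Sum>l<m. (G k l + R k l) * x l))"
    by (intro sum.cong refl) (simp only: row lessThan_iff)
  also have "\<dots> = (\<Sum>k<m. \<Sum>l<m. x k * x l * G k l) + (\<Sum>k<m. \<Sum>l<m. x k * x l * R k l)"
    by (simp add: sum_distrib_left algebra_simps sum.distrib)
  also have "\<dots> \<ge> (\<Sum>k<m. \<Sum>l<m. x k * x l * R k l)"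
    using G[of x] by simp
  finally have 1: "ev * S \<ge> (\<Sum>k<m. \<Sum>l<m. x k * x l * R k l)" .
  have "\<bar>\<Sum>k<m. \<Sum>l<m. x k * x l * R k l\<bar> \<le> (\<Sum>k<m. \<Sum>l<m. \<bar>x k * x l * R k l\<bar>)"
    by (rule order_trans[OF sum_abs sum_mono[OF sum_abs]])
  also have "\<dots> \<le> (\<Sum>k<m. \<Sum>l<m. \<bar>x k\<bar> * \<bar>x l\<bar> * \<delta>)"
    by (intro sum_mono) (auto simp: abs_mult intro!: mult_left_mono R)
  also have "\<dots> = (\<Sum>k<m. \<bar>x k\<bar>)\<^sup>2 * \<delta>"
    by (simp only: power2_eq_square sum_product) (simp only: sum_distrib_right)
  also have "\<dots> \<le> (S * real m) * \<delta>"
    using sum_squared_le_sum_of_squares[of "\<lambda>k. \<bar>x k\<bar>" "{..<m}"] \<delta>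
    by (intro mult_right_mono) (simp_all add: S_def)
  finally have "ev * S \<ge> (- (real m * \<delta>)) * S" using 1 by (simp add: algebra_simps)
  then show ?thesis by (rule mult_right_le_imp_le) (rule S)
qed

text \<open>Term \<open>i\<close> has zero gradient and positive semidefinite Hessian; the other
  terms disturb each derivative by at most \<open>N * cmax * \<delta>\<close> and lower the
  eigenvalue bound by \<open>m\<close> times that. The case \<open>\<epsilon> = \<delta> = 0\<close>
  is included for the Clifford angles.\<close>

lemma approx_local_min_of_small:
  fixes m :: nat and f :: "nat \<Rightarrow> (nat \<Rightarrow> real) \<Rightarrow> real"
  assumes f: "\<And>j. j < N \<Longrightarrow> multi_trig {..<m} (f j)"
    and i: "i < N" and c: "\<And>j. j < N \<Longrightarrow> \<bar>c j\<bar> \<le> cmax"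
    and min: "\<And>y. c i * f i x \<le> c i * f i y"
    and grad: "\<And>j k. j < N \<Longrightarrow> j \<noteq> i \<Longrightarrow> k < m \<Longrightarrow> \<bar>partial k (f j) x\<bar> \<le> \<delta>"
    and hess: "\<And>j k l. j < N \<Longrightarrow> j \<noteq> i \<Longrightarrow> k < m \<Longrightarrow> l < m \<Longrightarrow> \<bar>partial k (partial l (f j)) x\<bar> \<le> \<delta>"
    and \<delta>: "\<delta> \<ge> 0" "real N * cmax * \<delta> \<le> \<epsilon>" "real m * (real N * cmax * \<delta>) \<le> sqrt \<epsilon>"
  shows "approx_local_min m \<epsilon> (\<lambda>\<phi>. \<Sum>j<N. c j * f j \<phi>) x"
proof -
  let ?L = "\<lambda>\<phi>. \<Sum>j<N. c j * f j \<phi>"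
  have cmax: "cmax \<ge> 0" using c[OF i] by linarith
  have bound: "\<bar>\<Sum>j\<in>{..<N} - {i}. c j * g j\<bar> \<le> real N * cmax * \<delta>"
    if "\<And>j. j < N \<Longrightarrow> j \<noteq> i \<Longrightarrow> \<bar>g j\<bar> \<le> \<delta>" for g :: "nat \<Rightarrow> real"
  proof -
    have "\<bar>\<Sum>j\<in>{..<N} - {i}. c j * g j\<bar> \<le> (\<Sum>j\<in>{..<N} - {i}. \<bar>c j * g j\<bar>)" by (rule sum_abs)
    also have "\<dots> \<le> (\<Sum>j\<in>{..<N} - {i}. cmax * \<delta>)"
      using that c cmax by (intro sum_mono) (auto simp: abs_mult intro!: mult_mono)
    also have "\<dots> \<le> real N * cmax * \<delta>" using i cmax \<delta>(1) by (simp add: algebra_simps of_nat_diff)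
    finally show ?thesis .
  qed
  have g: "multi_trig {..<m} (\<lambda>\<phi>. c i * f i \<phi>)" by (rule multi_trig_cmult[OF f[OF i]])
  have pL: "partial k ?L = (\<lambda>\<phi>. \<Sum>j<N. c j * partial k (f j) \<phi>)" for k
    by (rule partial_sum) (use f in auto)
  have ppL: "partial k (partial l ?L) = (\<lambda>\<phi>. \<Sum>j<N. c j * partial k (partial l (f j)) \<phi>)" for k l
    unfolding pL by (rule partial_sum) (use multi_trig_partial f in auto)
  have split: "(\<Sum>j<N. h j) = h i + (\<Sum>j\<in>{..<N} - {i}. h j)" for h :: "nat \<Rightarrow> real"
    using i by (simp add: sum.remove)
  have "\<bar>partial k ?L x\<bar> \<le> \<epsilon>" if "k < m" for k
  proof -
    have "c i * partial k (f i) x = 0"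
      using multi_trig_partial_zero_at_min[OF g min] by (simp add: partial_cmult[OF f[OF i]])
    then have "\<bar>partial k ?L x\<bar> = \<bar>(\<Sum>j\<in>{..<N} - {i}. c j * partial k (f j) x)\<bar>"
      unfolding pL split[of "\<lambda>j. c j * partial k (f j) x"] by (simp only: add_0)
    also have "\<dots> \<le> real N * cmax * \<delta>" by (rule bound) (rule grad[OF _ _ that])
    finally show ?thesis using \<delta>(2) by linarith
  qed
  moreover have "ev \<ge> - sqrt \<epsilon>" if "eigenvalue (hessian m ?L x) ev" for ev
  proof -
    have "hessian m ?L x = mat m m (\<lambda>(k,l). c i * partial k (partial l (f i)) x
       + (\<Sum>j\<in>{..<N} - {i}. c j * partial k (partial l (f j)) x))"
      unfolding hessian_def ppL split[of "\<lambda>j. c j * partial _ (partial _ (f j)) x"] ..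
    with that have "eigenvalue (mat m m (\<lambda>(k,l). c i * partial k (partial l (f i)) x
       + (\<Sum>j\<in>{..<N} - {i}. c j * partial k (partial l (f j)) x))) ev" by simp
    then have "ev \<ge> - (real m * (real N * cmax * \<delta>))"
    proof (rule eigenvalue_lower_bound)
      show "0 \<le> (\<Sum>k<m. \<Sum>l<m. v k * v l * (c i * partial k (partial l (f i)) x))" for v
        using multi_trig_hessian_at_min[OF g min, of v]
        by (simp add: partial_cmult[OF f[OF i]] partial_cmult[OF multi_trig_partial[OF f[OF i]]])
    qed (intro bound hess)
    then show ?thesis using \<delta>(3) by linarith
  qed
  ultimately show ?thesis by (auto simp: approx_local_min_def)
qed

section \<open>Markov bound and measurability of the event\<close>

text \<open>Markov's inequality for the square of each \<open>h q\<close>, with the failure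
  probabilities added up. \<open>good\<close> is asked only almost everywhere, so that in the
  discrete case it can be checked on the support alone.\<close>

lemma (in prob_space) markov_union_bound:
  assumes Q: "finite Q" and G: "G \<in> events" and \<delta>: "\<delta> > 0"
    and int: "\<And>q. q \<in> Q \<Longrightarrow> integrable M (\<lambda>x. (h q x)\<^sup>2)"
    and B: "\<And>q. q \<in> Q \<Longrightarrow> expectation (\<lambda>x. (h q x)\<^sup>2) \<le> B"
    and good: "AE x in M. (\<forall>q\<in>Q. \<bar>h q x\<bar> < \<delta>) \<longrightarrow> x \<in> G"
  shows "prob G \<ge> 1 - real (card Q) * B / \<delta>\<^sup>2"
proof -
  define bad where "bad q = {x\<in>space M. (h q x)\<^sup>2 \<ge> \<delta>\<^sup>2}" for q
  have bad[measurable]: "bad q \<in> events" if "q \<in> Q" for q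
  proof -
    have [measurable]: "(\<lambda>x. (h q x)\<^sup>2) \<in> borel_measurable M" using int[OF that] by auto
    show ?thesis unfolding bad_def by measurable
  qed
  have "AE x in M. x \<in> space M - G \<longrightarrow> x \<in> (\<Union>q\<in>Q. bad q)"
    using good
  proof eventually_elim
    case (elim x)
    show ?case
    proof
      assume x: "x \<in> space M - G"
      then obtain q where q: "q \<in> Q" "\<delta> \<le> \<bar>h q x\<bar>" using elim by (meson DiffD2 not_less)
      then have "\<delta>\<^sup>2 \<le> (h q x)\<^sup>2" using \<delta> by (metis abs_le_square_iff abs_of_pos)
      then show "x \<in> (\<Union>q\<in>Q. bad q)" using q x by (auto simp: bad_def)
    qed
  qed
  then have "prob (space M - G) \<le> prob (\<Union>q\<in>Q. bad q)"
    using bad Q by (intro finite_measure_mono_AE) auto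
  also have "\<dots> \<le> (\<Sum>q\<in>Q. prob (bad q))"
    using bad Q by (intro finite_measure_subadditive_finite) auto
  also have "\<dots> \<le> (\<Sum>q\<in>Q. B / \<delta>\<^sup>2)"
  proof (intro sum_mono)
    fix q assume q: "q \<in> Q"
    have "prob (bad q) \<le> expectation (\<lambda>x. (h q x)\<^sup>2) / \<delta>\<^sup>2"
      unfolding bad_def using int[OF q] \<delta>
      by (intro integral_Markov_inequality_measure[where A = "{}"]) auto
    also have "\<dots> \<le> B / \<delta>\<^sup>2" by (intro divide_right_mono B q) simp
    finally show "prob (bad q) \<le> B / \<delta>\<^sup>2" .
  qed
  finally show ?thesis using prob_compl[OF G] by simp
qed

text \<open>An eigenvalue below \<open>s\<close> is a root of the characteristic polynomial; by compactness its existence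
  is a countable condition on approximate rational roots.\<close>
lemma measurable_eigenvalue_ge:
  fixes h :: "'a \<Rightarrow> nat \<Rightarrow> nat \<Rightarrow> real"
  assumes h: "\<And>k l. k < m \<Longrightarrow> l < m \<Longrightarrow> (\<lambda>x. h x k l) \<in> borel_measurable M"
  shows "{x\<in>space M. \<forall>ev. eigenvalue (mat m m (\<lambda>(k,l). h x k l)) ev \<longrightarrow> ev \<ge> s} \<in> sets M"
proof -
  \<comment> \<open>Leibniz expansion of the determinant of the matrix minus \<open>e\<close> times
    the identity; measurability in \<open>x\<close> and continuity in \<open>e\<close> are visible
    term by term.\<close>
  define p where "p e x = (\<Sum>\<pi> | \<pi> permutes {0..<m}. signof \<pi> * (\<Prod>k = 0..<m. h x k (\<pi> k) + - e * (if k = \<pi> k then 1 else 0)))"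
    for e x
  have ev: "eigenvalue (mat m m (\<lambda>(k,l). h x k l)) e \<longleftrightarrow> p e x = 0" for e x
  proof -
    let ?H = "mat m m (\<lambda>(k,l). h x k l)"
    have c: "?H \<in> carrier_mat m m" by simp
    have "det (char_matrix ?H e) = p e x"
      unfolding p_def det_def'[OF char_matrix_closed[OF c]]
    proof (intro sum.cong refl arg_cong2[where f = "(*)"] prod.cong)
      fix \<pi> k assume "\<pi> \<in> {\<pi>. \<pi> permutes {0..<m}}" "k \<in> {0..<m}"
      then have "k < m" "\<pi> k < m" using permutes_in_image[of \<pi> "{0..<m}" k] by auto
      then show "char_matrix ?H e $$ (k, \<pi> k) = h x k (\<pi> k) + - e * (if k = \<pi> k then 1 else 0)"
        by (simp add: char_matrix_def)
    qed
    then show ?thesis by (subst eigenvalue_det[of _ m]) auto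
  qed
  have meas[measurable]: "(\<lambda>x. p e x) \<in> borel_measurable M" for e
    unfolding p_def
  proof (intro borel_measurable_sum borel_measurable_times borel_measurable_prod borel_measurable_add)
    fix \<pi> k assume "\<pi> \<in> {\<pi>. \<pi> permutes {0..<m}}" "k \<in> {0..<m}"
    then have "k < m" "\<pi> k < m" using permutes_in_image[of \<pi> "{0..<m}" k] by auto
    then show "(\<lambda>x. h x k (\<pi> k)) \<in> borel_measurable M" by (rule h)
  qed auto
  have cont: "isCont (\<lambda>e. p e x) e" for x e
    unfolding p_def by (intro continuous_intros)
  \<comment> \<open>Both ends matter: \<open>- real n\<close> confines the approximate roots to a
    compact interval, where they accumulate at a true root, and the gap
    \<open>1 / real (Suc n)\<close> keeps that root strictly below \<open>s\<close>.\<close>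
  have char: "(\<exists>e<s. p e x = 0) \<longleftrightarrow> (\<exists>n::nat. \<forall>j::nat. \<exists>q::rat.
      - real n \<le> of_rat q \<and> of_rat q \<le> s - 1 / real (Suc n) \<and> \<bar>p (of_rat q) x\<bar> < 1 / real (Suc j))" for x
  proof
    assume "\<exists>e<s. p e x = 0"
    then obtain e where e: "e < s" "p e x = 0" by blast
    obtain n1 where n1: "- e < real n1" using reals_Archimedean2 by blast
    obtain n2 where n2: "inverse (real (Suc n2)) < s - e"
      using reals_Archimedean[of "s - e"] e(1) by auto
    define n where "n = max n1 n2"
    have lo: "- real n < e" using n1 by (simp add: n_def)
    have "1 / real (Suc n) \<le> inverse (real (Suc n2))"
      by (simp add: n_def inverse_eq_divide frac_le)
    then have hi: "e < s - 1 / real (Suc n)" using n2 by linarith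
    have "\<exists>q::rat. - real n \<le> of_rat q \<and> of_rat q \<le> s - 1 / real (Suc n) \<and> \<bar>p (of_rat q) x\<bar> < 1 / real (Suc j)" for j
    proof -
      have "((\<lambda>e. p e x) \<longlongrightarrow> p e x) (at e)" using cont[of e x] by (simp add: isCont_def)
      then obtain d where d: "d > 0" "\<And>y. y \<noteq> e \<Longrightarrow> dist y e < d \<Longrightarrow> dist (p y x) (p e x) < 1 / real (Suc j)"
        unfolding tendsto_iff eventually_at by (metis UNIV_I zero_less_divide_1_iff of_nat_0_less_iff zero_less_Suc)
      have "e < min (e + d) (s - 1 / real (Suc n))" using hi d(1) by simp
      then obtain q :: rat where q: "e < of_rat q" "of_rat q < min (e + d) (s - 1 / real (Suc n))"
        using of_rat_dense by blast
      then have "dist (p (of_rat q) x) (p e x) < 1 / real (Suc j)" by (intro d(2)) (auto simp: dist_real_def)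
      then show ?thesis using q lo e(2) by (intro exI[of _ q]) (auto simp: dist_real_def)
    qed
    then show "\<exists>n::nat. \<forall>j::nat. \<exists>q::rat. - real n \<le> of_rat q \<and> of_rat q \<le> s - 1 / real (Suc n)
        \<and> \<bar>p (of_rat q) x\<bar> < 1 / real (Suc j)" by blast
  next
    assume "\<exists>n::nat. \<forall>j::nat. \<exists>q::rat.
      - real n \<le> of_rat q \<and> of_rat q \<le> s - 1 / real (Suc n) \<and> \<bar>p (of_rat q) x\<bar> < 1 / real (Suc j)"
    then obtain n and q :: "nat \<Rightarrow> rat" where q: "\<And>j. - real n \<le> of_rat (q j)"
      "\<And>j. of_rat (q j) \<le> s - 1 / real (Suc n)" "\<And>j. \<bar>p (of_rat (q j)) x\<bar> < 1 / real (Suc j)" by metis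
    have "seq_compact {- real n..s - 1 / real (Suc n)}"
      using compact_Icc by (simp add: compact_eq_seq_compact_metric)
    then obtain e r where e: "e \<in> {- real n..s - 1 / real (Suc n)}" "strict_mono (r :: nat \<Rightarrow> nat)"
      "((\<lambda>j. of_rat (q j)) \<circ> r) \<longlonglongrightarrow> e"
      using q(1,2) by (elim seq_compactE[of _ "\<lambda>j. of_rat (q j)"]) auto
    have "(\<lambda>j. p (((\<lambda>j. of_rat (q j)) \<circ> r) j) x) \<longlonglongrightarrow> p e x"
      by (rule isCont_tendsto_compose[OF cont e(3)])
    moreover have "(\<lambda>j. p (((\<lambda>j. of_rat (q j)) \<circ> r) j) x) \<longlonglongrightarrow> 0"
    proof (rule tendsto_rabs_zero_cancel, rule tendsto_sandwich[where f = "\<lambda>_. 0" and h = "\<lambda>j. 1 / real (Suc (r j))"])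
      show "(\<lambda>j. 1 / real (Suc (r j))) \<longlonglongrightarrow> 0"
        using LIMSEQ_subseq_LIMSEQ[OF LIMSEQ_inverse_real_of_nat e(2)]
        by (simp only: o_def inverse_eq_divide)
      show "\<forall>\<^sub>F j in sequentially. \<bar>p (((\<lambda>j. of_rat (q j)) \<circ> r) j) x\<bar> \<le> 1 / real (Suc (r j))"
        unfolding o_def by (intro always_eventually allI less_imp_le q(3))
    qed (auto intro: tendsto_const)
    ultimately have "p e x = 0" by (rule LIMSEQ_unique)
    moreover have "e < s"
    proof -
      have "e \<le> s - 1 / real (Suc n)" using e(1) by simp
      moreover have "1 / real (Suc n) > 0" by simp
      ultimately show ?thesis by linarith
    qed
    ultimately show "\<exists>e<s. p e x = 0" by blast
  qed
  have "{x\<in>space M. \<forall>ev. eigenvalue (mat m m (\<lambda>(k,l). h x k l)) ev \<longrightarrow> ev \<ge> s}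
    = {x\<in>space M. \<not> (\<exists>e<s. p e x = 0)}"
    unfolding ev by (auto simp: not_less)
  also have "\<dots> \<in> sets M" unfolding char by measurable
  finally show ?thesis .
qed

section \<open>Averages over the torus and over the Clifford grid\<close>

abbreviation circle_measure :: "real measure" where
  "circle_measure \<equiv> uniform_measure lborel {0..<2*pi}"

lemma prob_space_circle: "prob_space circle_measure"
  by (rule prob_space_uniform_measure) auto

lemma sum_clifford_angles: "(\<Sum>t\<in>clifford_angles. g t) = g 0 + g (pi/2) + g pi + g (3*pi/2)"
  by (simp add: clifford_angles_def add.assoc)

lemma card_clifford_angles: "card clifford_angles = 4"
  by (simp add: clifford_angles_def)

lemma cos_sin_3pi_half: "cos (3*pi/2) = 0" "sin (3*pi/2) = -1"
proof -
  have "3*pi/2 = pi + pi/2" by simp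
  then show "cos (3*pi/2) = 0" "sin (3*pi/2) = -1" by (simp_all only: cos_add sin_add) auto
qed

lemma circle_measure_integral_trig:
  "(\<integral>t. (A + B * cos t + D * sin t)\<^sup>2 \<partial>circle_measure) = A\<^sup>2 + (B\<^sup>2 + D\<^sup>2) / 2"
proof -
  let ?g = "\<lambda>t. (A + B * cos t + D * sin t)\<^sup>2"
  \<comment> \<open>An antiderivative term by term; over a full period only its multiples of
    \<open>t\<close> contribute.\<close>
  let ?G = "\<lambda>t. A\<^sup>2 * t + B\<^sup>2 * (t + sin t * cos t) / 2 + D\<^sup>2 * (t - sin t * cos t) / 2
      + 2 * A * B * sin t - 2 * A * D * cos t + B * D * (sin t)\<^sup>2"
  have "circle_measure = density lborel (\<lambda>t. ennreal (indicator {0..<2*pi} t / (2*pi)))"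
    unfolding uniform_measure_def
    by (intro arg_cong2[where f = density] refl ext) (auto simp: indicator_def divide_ennreal simp flip: ennreal_1)
  then have "(\<integral>t. ?g t \<partial>circle_measure) = (\<integral>t. indicator {0..<2*pi} t / (2*pi) * ?g t \<partial>lborel)"
    by (simp add: integral_real_density)
  also have "\<dots> = (\<integral>t. (?g t * indicator {0..2*pi} t) / (2*pi) \<partial>lborel)"
  proof (rule integral_cong_AE)
    \<comment> \<open>The half-open interval of the measure and the closed one of the fundamental
      theorem differ by a null set.\<close>
    show "AE t in lborel. indicator {0..<2*pi} t / (2*pi) * ?g t = ?g t * indicator {0..2*pi} t / (2*pi)"
      using AE_lborel_singleton[of "2*pi"] by eventually_elim (auto simp: indicator_def)
  qed measurable
  also have "\<dots> = (\<integral>t. ?g t * indicator {0..2*pi} t \<partial>lborel) / (2*pi)" by simp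
  also have "(\<integral>t. ?g t * indicator {0..2*pi} t \<partial>lborel) = ?G (2*pi) - ?G 0"
  proof (rule integral_FTC_Icc_real)
    fix t :: real
    have c: "1 + (cos t * cos t - sin t * sin t) = 2 * (cos t * cos t)"
      and s: "1 - (cos t * cos t - sin t * sin t) = 2 * (sin t * sin t)"
      using sin_cos_squared_add3[of t] by linarith+
    have "DERIV ?G t :> A\<^sup>2 + B\<^sup>2 * (1 + (cos t * cos t - sin t * sin t)) / 2
        + D\<^sup>2 * (1 - (cos t * cos t - sin t * sin t)) / 2
        + 2 * A * B * cos t + 2 * A * D * sin t + B * D * (2 * sin t * cos t)"
      by (auto intro!: derivative_eq_intros)
    also have "A\<^sup>2 + B\<^sup>2 * (1 + (cos t * cos t - sin t * sin t)) / 2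
        + D\<^sup>2 * (1 - (cos t * cos t - sin t * sin t)) / 2
        + 2 * A * B * cos t + 2 * A * D * sin t + B * D * (2 * sin t * cos t) = ?g t"
      unfolding c s by (simp add: power2_eq_square algebra_simps)
    finally show "DERIV ?G t :> ?g t" .
    show "isCont ?g t" by (intro continuous_intros)
  qed simp
  also have "\<dots> / (2*pi) = A\<^sup>2 + (B\<^sup>2 + D\<^sup>2) / 2" by (simp add: field_simps)
  finally show ?thesis .
qed

text \<open>Both sides equal \<open>A\<^sup>2 + (B\<^sup>2 + D\<^sup>2) / 2\<close>: frequencies one
  and two average out over the four points as they do over the circle.\<close>

lemma circle_measure_integral_grid:
  assumes "\<forall>t. g t = A + B * cos t + D * sin t"
  shows "(\<integral>t. (g t)\<^sup>2 \<partial>circle_measure) = (\<Sum>t\<in>clifford_angles. (g t)\<^sup>2) / 4"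
  by (simp only: assms[rule_format] circle_measure_integral_trig sum_clifford_angles cos_sin_3pi_half)
     (simp add: power2_eq_square algebra_simps)

text \<open>\<open>join\<close> overwrites \<open>\<theta>\<close> on \<open>F\<close>, so only its
  fixed components count. Keeping \<open>\<theta>\<close> total lets an angle pass from free to
  fixed by a function update.\<close>

definition sq_mean :: "nat set \<Rightarrow> (nat \<Rightarrow> real) \<Rightarrow> ((nat \<Rightarrow> real) \<Rightarrow> real) \<Rightarrow> real" where
  "sq_mean F \<theta> f = (\<integral>\<phi>. (f (join F \<theta> \<phi>))\<^sup>2 \<partial>unif_F F)"

lemma prob_space_unif_F: "prob_space (unif_F F)"
  unfolding unif_F_def by (intro prob_space_PiM prob_space_circle)

lemma measurable_join: "(\<lambda>\<phi>. join F \<theta> \<phi> k) \<in> borel_measurable (unif_F F)"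
proof (cases "k \<in> F")
  case True
  then have "(\<lambda>\<phi>. \<phi> k) \<in> measurable (unif_F F) circle_measure"
    unfolding unif_F_def by (rule measurable_component_singleton)
  then show ?thesis using True by (simp add: join_def measurable_cong_sets[of _ _ circle_measure borel])
qed (simp add: join_def)

lemma integrable_join_sq:
  assumes "multi_trig K f"
  shows "integrable (unif_F F) (\<lambda>\<phi>. (f (join F \<theta> \<phi>))\<^sup>2)"
proof -
  interpret prob_space "unif_F F" by (rule prob_space_unif_F)
  obtain B where B: "\<forall>x. \<bar>f x\<bar> \<le> B" using multi_trig_bounded[OF assms] by blast
  note [measurable] = multi_trig_measurable[OF assms measurable_join[of F \<theta>]]
  show ?thesis
  proof (rule integrable_const_bound[of _ "B\<^sup>2"])
    show "AE \<phi> in unif_F F. norm ((f (join F \<theta> \<phi>))\<^sup>2) \<le> B\<^sup>2"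
      using B by (auto intro!: always_eventually order_trans[OF _ abs_ge_self]
        simp flip: abs_le_square_iff)
  qed measurable
qed

lemma join_insert:
  assumes "k \<notin> F"
  shows "join (insert k F) \<theta> (\<phi>(k := y)) = (join F \<theta> \<phi>)(k := y)"
    and "join F (\<theta>(k := y)) \<phi> = (join F \<theta> \<phi>)(k := y)"
  using assms by (auto simp: join_def fun_eq_iff)

text \<open>Fubini in one coordinate, then the four-point rule. The first form drives the induction
  on \<open>F\<close>; the second keeps the sum under the integral for pointwise comparison.\<close>

lemma sq_mean_insert:
  assumes F: "finite F" "k \<notin> F" and f: "multi_trig K f"
  shows "sq_mean (insert k F) \<theta> f = (\<Sum>y\<in>clifford_angles. sq_mean F (\<theta>(k := y)) f) / 4"
    and "sq_mean (insert k F) \<theta> f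
      = (\<integral>\<phi>. (\<Sum>y\<in>clifford_angles. (f ((join F \<theta> \<phi>)(k := y)))\<^sup>2) / 4 \<partial>unif_F F)"
proof -
  interpret product_sigma_finite "\<lambda>_. circle_measure"
    by (simp add: product_sigma_finite_def prob_space_imp_sigma_finite prob_space_circle)
  have "sq_mean (insert k F) \<theta> f = (\<integral>\<phi>. (\<integral>y. (f (join (insert k F) \<theta> (\<phi>(k := y))))\<^sup>2 \<partial>circle_measure) \<partial>unif_F F)"
    unfolding sq_mean_def unif_F_def
    by (rule product_integral_insert) (use F integrable_join_sq[OF f] in \<open>auto simp: unif_F_def\<close>)
  also have "\<dots> = (\<integral>\<phi>. (\<Sum>y\<in>clifford_angles. (f ((join F \<theta> \<phi>)(k := y)))\<^sup>2) / 4 \<partial>unif_F F)"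
  proof (rule Bochner_Integration.integral_cong[OF refl])
    fix \<phi>
    obtain A B D where "\<forall>t. f ((join F \<theta> \<phi>)(k := t)) = A + B * cos t + D * sin t"
      using multi_trig_coord[OF f] by blast
    from circle_measure_integral_grid[OF this]
    show "(\<integral>y. (f (join (insert k F) \<theta> (\<phi>(k := y))))\<^sup>2 \<partial>circle_measure)
        = (\<Sum>y\<in>clifford_angles. (f ((join F \<theta> \<phi>)(k := y)))\<^sup>2) / 4"
      by (simp only: join_insert(1)[OF F(2)])
  qed
  finally show 2: "sq_mean (insert k F) \<theta> f
      = (\<integral>\<phi>. (\<Sum>y\<in>clifford_angles. (f ((join F \<theta> \<phi>)(k := y)))\<^sup>2) / 4 \<partial>unif_F F)" .
  also have "\<dots> = (\<Sum>y\<in>clifford_angles. sq_mean F (\<theta>(k := y)) f) / 4"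
    unfolding sq_mean_def join_insert(2)[OF F(2), symmetric]
    by (simp add: integrable_join_sq[OF f])
  finally show "sq_mean (insert k F) \<theta> f = (\<Sum>y\<in>clifford_angles. sq_mean F (\<theta>(k := y)) f) / 4" .
qed

text \<open>In the angle \<open>k\<close>, differentiation removes the mean \<open>A\<close> and
  rotates \<open>(B, D)\<close>, so the average over its four values can only drop by
  \<open>A\<^sup>2\<close>. Integrating over the other angles preserves this.\<close>

lemma sq_mean_partial_free:
  assumes F: "finite F" "k \<in> F" and f: "multi_trig K f"
  shows "sq_mean F \<theta> (partial k f) \<le> sq_mean F \<theta> f"
proof -
  obtain E where E: "F = insert k E" "k \<notin> E" "finite E"
    using F by (metis Set.set_insert finite_insert)
  have int: "integrable (unif_F E) (\<lambda>\<phi>. (\<Sum>y\<in>clifford_angles. (g ((join E \<theta> \<phi>)(k := y)))\<^sup>2) / 4)"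
    if "multi_trig K g" for g
    unfolding join_insert(2)[OF E(2), symmetric]
    by (intro integrable_divide_zero Bochner_Integration.integrable_sum integrable_join_sq[OF that])
  show ?thesis
    unfolding E(1) sq_mean_insert(2)[OF E(3,2) f] sq_mean_insert(2)[OF E(3,2) multi_trig_partial[OF f]]
  proof (rule integral_mono[OF int[OF multi_trig_partial[OF f]] int[OF f]])
    fix \<phi>
    obtain A B D where *: "\<forall>t. f ((join E \<theta> \<phi>)(k := t)) = A + B * cos t + D * sin t"
      using multi_trig_coord[OF f] by blast
    show "(\<Sum>y\<in>clifford_angles. (partial k f ((join E \<theta> \<phi>)(k := y)))\<^sup>2) / 4
        \<le> (\<Sum>y\<in>clifford_angles. (f ((join E \<theta> \<phi>)(k := y)))\<^sup>2) / 4"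
      by (simp only: partial_coord[OF *] *[rule_format] sum_clifford_angles cos_sin_3pi_half)
         (simp add: power2_eq_square algebra_simps)
  qed
qed

text \<open>A fixed angle is not averaged over, so the shift rule takes the place of the pointwise
  comparison; the square of half a difference is at most half the sum of the squares.\<close>

lemma sq_mean_partial_fixed:
  assumes k: "k \<notin> F" and f: "multi_trig K f"
  shows "sq_mean F \<theta> (partial k f)
    \<le> (sq_mean F (\<theta>(k := \<theta> k + pi/2)) f + sq_mean F (\<theta>(k := \<theta> k - pi/2)) f) / 2"
proof -
  let ?p = "\<lambda>\<phi>. f (join F (\<theta>(k := \<theta> k + pi/2)) \<phi>)"
  let ?m = "\<lambda>\<phi>. f (join F (\<theta>(k := \<theta> k - pi/2)) \<phi>)"
  have "sq_mean F \<theta> (partial k f) \<le> (\<integral>\<phi>. ((?p \<phi>)\<^sup>2 + (?m \<phi>)\<^sup>2) / 2 \<partial>unif_F F)"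
    unfolding sq_mean_def
  proof (rule integral_mono)
    fix \<phi>
    have "partial k f (join F \<theta> \<phi>) = (?p \<phi> - ?m \<phi>) / 2"
      unfolding multi_trig_parameter_shift[OF f] join_insert(2)[OF k] using k by (simp add: join_def)
    moreover have "((a - b) / 2)\<^sup>2 \<le> (a\<^sup>2 + b\<^sup>2) / 2" for a b :: real
      using zero_le_power2[of "a + b"] by (simp add: power2_eq_square field_simps)
    ultimately show "(partial k f (join F \<theta> \<phi>))\<^sup>2 \<le> ((?p \<phi>)\<^sup>2 + (?m \<phi>)\<^sup>2) / 2" by (simp only:)
  qed (intro integrable_divide_zero Bochner_Integration.integrable_add integrable_join_sq[OF f]
        integrable_join_sq[OF multi_trig_partial[OF f]])+
  also have "\<dots> = (sq_mean F (\<theta>(k := \<theta> k + pi/2)) f + sq_mean F (\<theta>(k := \<theta> k - pi/2)) f) / 2"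
    unfolding sq_mean_def by (simp add: integrable_join_sq[OF f])
  finally show ?thesis .
qed

text \<open>The free angles are replaced one by one by their four grid values. As a result the
  bounds assumed for continuous averages serve both conclusions.\<close>

lemma sq_mean_eq_grid:
  assumes "finite F" and f: "multi_trig K f"
  shows "sq_mean F \<theta> f = (\<Sum>\<phi>\<in>PiE F (\<lambda>_. clifford_angles). (f (join F \<theta> \<phi>))\<^sup>2) / 4 ^ card F"
  using assms(1)
proof (induction F arbitrary: \<theta> rule: finite_induct)
  case empty
  interpret prob_space "unif_F {}" by (rule prob_space_unif_F)
  show ?case by (simp add: sq_mean_def join_def prob_space)
next
  case (insert k F)
  let ?P = "\<lambda>F. PiE F (\<lambda>_. clifford_angles)"
  have "(\<Sum>\<phi>\<in>?P (insert k F). (f (join (insert k F) \<theta> \<phi>))\<^sup>2)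
     = (\<Sum>(y,\<phi>)\<in>clifford_angles \<times> ?P F. (f (join (insert k F) \<theta> (\<phi>(k := y))))\<^sup>2)"
    unfolding PiE_insert_eq
    by (subst sum.reindex) (use insert(2) in \<open>auto intro!: inj_combinator sum.cong\<close>)
  also have "\<dots> = (\<Sum>y\<in>clifford_angles. \<Sum>\<phi>\<in>?P F. (f (join F (\<theta>(k := y)) \<phi>))\<^sup>2)"
    by (subst sum.cartesian_product) (simp only: join_insert[OF insert(2)])
  finally have "(\<Sum>\<phi>\<in>?P (insert k F). (f (join (insert k F) \<theta> \<phi>))\<^sup>2)
     = (\<Sum>y\<in>clifford_angles. \<Sum>\<phi>\<in>?P F. (f (join F (\<theta>(k := y)) \<phi>))\<^sup>2)" .
  then show ?case
    unfolding sq_mean_insert(1)[OF insert(1,2) f] insert.IH card_insert_disjoint[OF insert(1,2)]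
    by (simp add: sum_divide_distrib mult.commute)
qed

section \<open>Shift budget and derivatives\<close>

text \<open>\<open>r\<close> is a budget of components that may still be shifted. Components are
  counted, not steps, so the double shift produced by differentiating twice in one fixed direction
  is covered.\<close>

definition shift_bounded :: "nat \<Rightarrow> nat set \<Rightarrow> (nat \<Rightarrow> real) \<Rightarrow> real \<Rightarrow> nat \<Rightarrow> ((nat \<Rightarrow> real) \<Rightarrow> real) \<Rightarrow> bool" where
  "shift_bounded m F \<theta> B r f \<longleftrightarrow> (\<forall>a::nat \<Rightarrow> int.
     (\<forall>k. a k \<noteq> 0 \<longrightarrow> k \<in> {..<m} - F) \<and> card {k. a k \<noteq> 0} \<le> r \<longrightarrow>
     sq_mean F (\<lambda>k. \<theta> k + real_of_int (a k) * (pi/2)) f \<le> B)"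

lemma shift_bounded_0: "shift_bounded m F \<theta> B r f \<Longrightarrow> sq_mean F \<theta> f \<le> B"
  unfolding shift_bounded_def by (drule spec[of _ "\<lambda>_. 0"]) simp

text \<open>A derivative in a free direction does not increase the mean square; one in a fixed
  direction shifts component \<open>k\<close> both ways and spends one unit of the budget.\<close>

lemma shift_bounded_partial:
  assumes B: "shift_bounded m F \<theta> B (Suc r) f" and f: "multi_trig K f" and k: "k < m" and F: "F \<subseteq> {..<m}"
  shows "shift_bounded m F \<theta> B r (partial k f)"
  unfolding shift_bounded_def
proof (intro allI impI, elim conjE)
  fix a :: "nat \<Rightarrow> int"
  assume a: "\<forall>k. a k \<noteq> 0 \<longrightarrow> k \<in> {..<m} - F" and r: "card {k. a k \<noteq> 0} \<le> r"
  let ?\<theta> = "\<lambda>a k. \<theta> k + real_of_int (a k) * (pi/2)"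
  have fin: "finite F" using F finite_subset by blast
  have fina: "finite {k. a k \<noteq> 0}" by (rule finite_subset[of _ "{..<m}"]) (use a in auto)
  show "sq_mean F (?\<theta> a) (partial k f) \<le> B"
  proof (cases "k \<in> F")
    case True
    have "sq_mean F (?\<theta> a) (partial k f) \<le> sq_mean F (?\<theta> a) f"
      by (rule sq_mean_partial_free[OF fin True f])
    also have "\<dots> \<le> B" using B a r unfolding shift_bounded_def by simp
    finally show ?thesis .
  next
    case False
    \<comment> \<open>An arbitrary \<open>z\<close> covers both directions, including the cases
      where component \<open>k\<close> was already shifted or returns to 0.\<close>
    have bound: "sq_mean F (?\<theta> (a(k := z))) f \<le> B" for z
    proof -
      have "card {l. (a(k := z)) l \<noteq> 0} \<le> card (insert k {k. a k \<noteq> 0})"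
        by (rule card_mono) (use fina in auto)
      also have "\<dots> \<le> Suc r" using r fina by (simp add: card_insert_if)
      finally have "card {l. (a(k := z)) l \<noteq> 0} \<le> Suc r" .
      moreover have "\<forall>l. (a(k := z)) l \<noteq> 0 \<longrightarrow> l \<in> {..<m} - F" using a k False by auto
      ultimately show ?thesis using B unfolding shift_bounded_def by blast
    qed
    have "(?\<theta> a)(k := ?\<theta> a k + pi/2) = ?\<theta> (a(k := a k + 1))"
      "(?\<theta> a)(k := ?\<theta> a k - pi/2) = ?\<theta> (a(k := a k - 1))"
      by (auto simp: fun_eq_iff distrib_right left_diff_distrib)
    then show ?thesis
      using sq_mean_partial_fixed[OF False f, of "?\<theta> a"] bound[of "a k + 1"] bound[of "a k - 1"] by simp
  qed
qed

lemma clifford_angles_cos_sin: "t \<in> clifford_angles \<Longrightarrow> cos t = 0 \<or> sin t = 0"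
proof -
  have "\<forall>t\<in>clifford_angles. cos t = 0 \<or> sin t = 0"
    by (simp add: clifford_angles_def cos_sin_3pi_half)
  then show "t \<in> clifford_angles \<Longrightarrow> cos t = 0 \<or> sin t = 0" by blast
qed

lemma cos_sin_quarter_shift:
  fixes t :: real
  assumes "cos t = 0 \<or> sin t = 0"
  shows "cos (t + pi/2) = 0 \<or> sin (t + pi/2) = 0" "cos (t - pi/2) = 0 \<or> sin (t - pi/2) = 0"
  using assms by (auto simp: cos_add sin_add cos_diff sin_diff)

text \<open>\<open>a\<close> is the denominator accumulated so far, and the half in the shift rule
  doubles it. Both shifted points still satisfy the angle condition, so integrality applies to
  them.\<close>

lemma partial_lattice:
  assumes f: "multi_trig K f"
    and Z: "\<And>x. (\<And>k. k < m \<Longrightarrow> cos (x k) = 0 \<or> sin (x k) = 0) \<Longrightarrow> a * f x \<in> \<int>"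
    and x: "\<And>k. k < m \<Longrightarrow> cos (x k) = 0 \<or> sin (x k) = 0"
  shows "2 * a * partial k f x \<in> \<int>"
proof -
  have "2 * a * partial k f x = a * f (x(k := x k + pi/2)) - a * f (x(k := x k - pi/2))"
    unfolding multi_trig_parameter_shift[OF f] by (simp add: right_diff_distrib)
  also have "\<dots> \<in> \<int>"
    using x cos_sin_quarter_shift by (intro Ints_diff Z) auto
  finally show ?thesis .
qed

text \<open>The hypothesis concerns extensional points of the box, whereas points of the product
  space have arbitrary real coordinates. Replacing each angle by one in the box with the same cosine
  and sine bridges the gap.\<close>

lemma multi_trig_const_of_box:
  assumes f: "multi_trig {..<m} f"
    and const: "\<And>\<phi>. \<phi> \<in> PiE F (\<lambda>_. {0..<2*pi}) \<Longrightarrow> f (join F \<theta> \<phi>) = a"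
  shows "f (join F \<theta> \<phi>) = a"
proof -
  have "\<exists>t. 0 \<le> t \<and> t < 2*pi \<and> cos (\<phi> k) = cos t \<and> sin (\<phi> k) = sin t" for k
    using sincos_total_2pi[of "cos (\<phi> k)" "sin (\<phi> k)"] by (metis sin_cos_squared_add2)
  then obtain \<psi> where \<psi>: "\<And>k. 0 \<le> \<psi> k \<and> \<psi> k < 2*pi \<and> cos (\<phi> k) = cos (\<psi> k) \<and> sin (\<phi> k) = sin (\<psi> k)"
    by metis
  have "f (join F \<theta> \<phi>) = f (join F \<theta> (restrict \<psi> F))"
    by (rule multi_trig_periodic[OF f]) (simp add: join_def \<psi>)
  also have "\<dots> = a" by (rule const) (simp add: \<psi>)
  finally show ?thesis .
qed

section \<open>The two probability bounds\<close>

text \<open>Circuits have left the picture: only the trigonometric form, the bound 1 and integrality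
  at Clifford points remain of them. Both conclusions use the same family of derivatives, with
  threshold \<open>\<epsilon> / D\<close> in one and \<open>1/4\<close> in the other.\<close>

lemma landscape_bounds:
  fixes f :: "nat \<Rightarrow> (nat \<Rightarrow> real) \<Rightarrow> real"
  assumes f: "\<And>j. j < N \<Longrightarrow> multi_trig {..<m} (f j)"
    and f1: "\<And>j x. j < N \<Longrightarrow> \<bar>f j x\<bar> \<le> 1"
    and fZ: "\<And>j x. j < N \<Longrightarrow> (\<And>k. k < m \<Longrightarrow> cos (x k) = 0 \<or> sin (x k) = 0) \<Longrightarrow> f j x \<in> \<int>"
    and i: "i < N" and c: "\<And>j. j < N \<Longrightarrow> \<bar>c j\<bar> \<le> cmax"
    and F: "F \<subseteq> {..<m}" and \<theta>: "\<And>k. k \<in> {..<m} - F \<Longrightarrow> \<theta> k \<in> clifford_angles"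
    and fi: "\<And>\<phi>. \<phi> \<in> PiE F (\<lambda>_. {0..<2*pi}) \<Longrightarrow> c i * f i (join F \<theta> \<phi>) = - \<bar>c i\<bar>"
    and B: "B \<ge> 0" "\<And>j. j < N \<Longrightarrow> j \<noteq> i \<Longrightarrow> shift_bounded m F \<theta> B 2 (f j)"
  defines "L \<equiv> \<lambda>\<phi>. \<Sum>j<N. c j * f j \<phi>"
  shows "0 < \<epsilon> \<Longrightarrow> \<epsilon> \<le> 1 \<Longrightarrow>
      measure (unif_F F) {\<phi> \<in> space (unif_F F). approx_local_min m \<epsilon> L (join F \<theta> \<phi>)}
      \<ge> 1 - (1 + real N + real m + cmax) ^ 9 * B / \<epsilon>\<^sup>2"
    and "measure_pmf.prob (unif_clifford_F F) {\<phi>. approx_local_min m 0 L (join F \<theta> \<phi>)}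
      \<ge> 1 - 16 * (1 + real N + real m) ^ 9 * B"
proof -
  define Q where "Q = ({..<N} - {i}) \<times> {..<m} \<times> {..m}"
  \<comment> \<open>the index \<open>l = m\<close> encodes the first derivative\<close>
  define h where "h = (\<lambda>(j,k,l). if l = m then partial k (f j) else partial k (partial l (f j)))"
  have finQ: "finite Q" by (simp add: Q_def)
  have finF: "finite F" using F finite_subset by blast
  have cardQ: "real (card Q) \<le> real N * (real m * (1 + real m))"
  proof -
    have "card Q \<le> N * (m * (1 + m))"
      unfolding Q_def card_cartesian_product using card_Diff1_le[of "{..<N}" i] by (intro mult_le_mono) auto
    then have "real (card Q) \<le> real (N * (m * (1 + m)))" by (rule of_nat_mono)
    then show ?thesis by (simp add: algebra_simps)
  qed
  have h: "multi_trig {..<m} (h q)" if "q \<in> Q" for q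
  proof -
    from that obtain j k l where q: "q = (j,k,l)" "j < N" "j \<noteq> i" "k < m" "l \<le> m"
      by (auto simp: Q_def)
    show ?thesis using f[OF q(2)] by (simp add: h_def q(1) multi_trig_partial)
  qed
  have hB: "sq_mean F \<theta> (h q) \<le> B" if "q \<in> Q" for q
  proof -
    from that obtain j k l where q: "q = (j,k,l)" "j < N" "j \<noteq> i" "k < m" "l \<le> m"
      by (auto simp: Q_def)
    have B2: "shift_bounded m F \<theta> B (Suc (Suc 0)) (f j)" using B(2)[OF q(2,3)] by (simp add: numeral_2_eq_2)
    have "sq_mean F \<theta> (partial k (f j)) \<le> B"
      by (rule shift_bounded_0[OF shift_bounded_partial[OF B2 f[OF q(2)] q(4) F]])
    moreover have "sq_mean F \<theta> (partial k (partial l (f j))) \<le> B" if "l < m"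
      by (rule shift_bounded_0[OF shift_bounded_partial[OF
            shift_bounded_partial[OF B2 f[OF q(2)] that F] multi_trig_partial[OF f[OF q(2)]] q(4) F]])
    ultimately show ?thesis using q(1,5) by (auto simp: h_def)
  qed
  have min: "c i * f i (join F \<theta> \<phi>) \<le> c i * f i y" for \<phi> y
  proof -
    have "c i * f i (join F \<theta> \<phi>) = - \<bar>c i\<bar>"
      by (rule multi_trig_const_of_box[OF multi_trig_cmult[OF f[OF i]] fi])
    moreover have "\<bar>c i * f i y\<bar> \<le> \<bar>c i\<bar>"
      using f1[OF i, of y] by (simp add: abs_mult mult_left_le)
    ultimately show ?thesis by linarith
  qed
  have cmax: "cmax \<ge> 0" using c[OF i] by linarith
  have good: "approx_local_min m \<epsilon> L (join F \<theta> \<phi>)"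
    if "\<forall>q\<in>Q. \<bar>h q (join F \<theta> \<phi>)\<bar> \<le> \<delta>" "\<delta> \<ge> 0" "real N * cmax * \<delta> \<le> \<epsilon>"
      "real m * (real N * cmax * \<delta>) \<le> sqrt \<epsilon>" for \<epsilon> \<delta> \<phi>
    unfolding L_def
  proof (rule approx_local_min_of_small[where f = f and c = c and i = i and N = N and cmax = cmax and \<delta> = \<delta>])
    fix j k assume "j < N" "j \<noteq> i" "k < m"
    then show "\<bar>partial k (f j) (join F \<theta> \<phi>)\<bar> \<le> \<delta>"
      using bspec[OF that(1), of "(j,k,m)"] by (simp add: Q_def h_def)
  next
    fix j k l assume "j < N" "j \<noteq> i" "k < m" "l < m"
    then show "\<bar>partial k (partial l (f j)) (join F \<theta> \<phi>)\<bar> \<le> \<delta>"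
      using bspec[OF that(1), of "(j,k,l)"] by (simp add: Q_def h_def)
  qed (use f i c min that(2-4) in blast)+
  show "measure (unif_F F) {\<phi> \<in> space (unif_F F). approx_local_min m \<epsilon> L (join F \<theta> \<phi>)}
      \<ge> 1 - (1 + real N + real m + cmax) ^ 9 * B / \<epsilon>\<^sup>2" if \<epsilon>: "0 < \<epsilon>" "\<epsilon> \<le> 1"
  proof -
    interpret prob_space "unif_F F" by (rule prob_space_unif_F)
    let ?X = "1 + real N + real m + cmax"
    \<comment> \<open>\<open>D\<close> dominates the error factors of gradient and Hessian,
      \<open>N * cmax\<close> and \<open>m * N * cmax\<close>; the added ones keep it positive when
      \<open>m\<close> or \<open>cmax\<close> is 0.\<close>
    define D where "D = real N * (1 + real m) * (1 + cmax)"
    have D: "D > 0" using i cmax by (simp add: D_def)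
    define \<delta> where "\<delta> = \<epsilon> / D"
    have \<delta>: "\<delta> > 0" using \<epsilon> D by (simp add: \<delta>_def)
    have ND: "real N * cmax \<le> D" "real m * (real N * cmax) \<le> D"
      using cmax by (simp_all add: D_def algebra_simps)
    \<comment> \<open>The restriction \<open>\<epsilon> \<le> 1\<close> enters here and lets one
      threshold serve gradient and Hessian.\<close>
    have "\<epsilon> \<le> sqrt \<epsilon>"
      using \<epsilon> by (intro real_le_rsqrt) (simp add: power2_eq_square mult_left_le)
    moreover have "a * \<delta> \<le> \<epsilon>" if "a \<le> D" for a
      using mult_right_mono[OF that, of \<delta>] \<delta> D by (simp add: \<delta>_def)
    ultimately have \<delta>': "real N * cmax * \<delta> \<le> \<epsilon>" "real m * (real N * cmax * \<delta>) \<le> sqrt \<epsilon>"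
      using ND by (force simp: mult.assoc)+
    have L: "partial k L = (\<lambda>\<phi>. \<Sum>j<N. c j * partial k (f j) \<phi>)" for k
      unfolding L_def by (rule partial_sum) (use f in auto)
    have LL: "partial k (partial l L) = (\<lambda>\<phi>. \<Sum>j<N. c j * partial k (partial l (f j)) \<phi>)" for k l
      unfolding L by (rule partial_sum) (use f multi_trig_partial in auto)
    have [measurable]: "(\<lambda>\<phi>. partial k L (join F \<theta> \<phi>)) \<in> borel_measurable (unif_F F)" for k
      unfolding L by (intro borel_measurable_sum borel_measurable_times borel_measurable_const
        multi_trig_measurable[OF multi_trig_partial[OF f] measurable_join]) auto
    have [measurable]: "(\<lambda>\<phi>. partial k (partial l L) (join F \<theta> \<phi>)) \<in> borel_measurable (unif_F F)" for k l
      unfolding LL by (intro borel_measurable_sum borel_measurable_times borel_measurable_const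
        multi_trig_measurable[OF multi_trig_partial[OF multi_trig_partial[OF f]] measurable_join]) auto
    have "{\<phi> \<in> space (unif_F F). approx_local_min m \<epsilon> L (join F \<theta> \<phi>)}
      = {\<phi> \<in> space (unif_F F). \<forall>k<m. \<bar>partial k L (join F \<theta> \<phi>)\<bar> \<le> \<epsilon>} \<inter>
        {\<phi> \<in> space (unif_F F). \<forall>ev. eigenvalue (mat m m (\<lambda>(k,l). partial k (partial l L) (join F \<theta> \<phi>))) ev
           \<longrightarrow> ev \<ge> - sqrt \<epsilon>}"
      by (auto simp: approx_local_min_def hessian_def)
    also have "\<dots> \<in> events"
      by (intro sets.Int measurable_eigenvalue_ge) measurable
    finally have G: "{\<phi> \<in> space (unif_F F). approx_local_min m \<epsilon> L (join F \<theta> \<phi>)} \<in> events" .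
    have "prob {\<phi> \<in> space (unif_F F). approx_local_min m \<epsilon> L (join F \<theta> \<phi>)}
        \<ge> 1 - real (card Q) * B / \<delta>\<^sup>2"
    proof (rule markov_union_bound[OF finQ G \<delta>, where h = "\<lambda>q \<phi>. h q (join F \<theta> \<phi>)"])
      show "AE \<phi> in unif_F F. (\<forall>q\<in>Q. \<bar>h q (join F \<theta> \<phi>)\<bar> < \<delta>) \<longrightarrow>
          \<phi> \<in> {\<phi> \<in> space (unif_F F). approx_local_min m \<epsilon> L (join F \<theta> \<phi>)}"
        using good[OF _ less_imp_le[OF \<delta>] \<delta>'] by (intro AE_I2) (auto simp: less_imp_le)
    qed (use hB integrable_join_sq[OF h] in \<open>auto simp: sq_mean_def\<close>)
    moreover have "real (card Q) * B / \<delta>\<^sup>2 \<le> ?X ^ 9 * B / \<epsilon>\<^sup>2"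
    proof -
      have D2: "D \<le> ?X * ?X * ?X" unfolding D_def using cmax by (intro mult_mono) auto
      \<comment> \<open>Three factors count the derivatives and twice three come from
        \<open>D\<^sup>2\<close>.\<close>
      have "real (card Q) * D\<^sup>2 \<le> (?X * (?X * ?X)) * (?X * ?X * ?X)\<^sup>2"
        using cmax D D2 by (intro mult_mono order_trans[OF cardQ] power_mono) auto
      also have "\<dots> = ?X ^ 9" by (simp add: eval_nat_numeral)
      finally have "real (card Q) * D\<^sup>2 * B / \<epsilon>\<^sup>2 \<le> ?X ^ 9 * B / \<epsilon>\<^sup>2"
        using B(1) by (intro divide_right_mono mult_right_mono) auto
      then show ?thesis by (simp add: \<delta>_def power_divide mult_ac)
    qed
    ultimately show ?thesis by linarith
  qed
  show "measure_pmf.prob (unif_clifford_F F) {\<phi>. approx_local_min m 0 L (join F \<theta> \<phi>)}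
      \<ge> 1 - 16 * (1 + real N + real m) ^ 9 * B"
  proof -
    let ?S = "PiE F (\<lambda>_. clifford_angles)"
    let ?X = "1 + real N + real m"
    have finS: "finite ?S" using finF by (intro finite_PiE) (auto simp: clifford_angles_def)
    have S: "?S \<noteq> {}" by (simp add: PiE_eq_empty_iff clifford_angles_def)
    have cardS: "card ?S = 4 ^ card F" using finF by (simp add: card_PiE card_clifford_angles)
    have set: "set_pmf (unif_clifford_F F) = ?S"
      unfolding unif_clifford_F_def using finS S by simp
    have mean: "measure_pmf.expectation (unif_clifford_F F) (\<lambda>\<phi>. (g (join F \<theta> \<phi>))\<^sup>2) = sq_mean F \<theta> g"
      if "multi_trig {..<m} g" for g
      unfolding unif_clifford_F_def integral_pmf_of_set[OF S finS] sq_mean_eq_grid[OF finF that] cardS by simp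
    \<comment> \<open>Every \<open>h q\<close> is a multiple of 1/4 at Clifford points, so a modulus
      strictly below 1/4 forces 0.\<close>
    have zero: "h q (join F \<theta> \<phi>) = 0"
      if q: "q \<in> Q" and \<phi>: "\<phi> \<in> ?S" and small: "\<bar>h q (join F \<theta> \<phi>)\<bar> < 1/4" for q \<phi>
    proof -
      obtain j k l where jkl: "q = (j,k,l)" "j < N" "k < m" "l \<le> m"
        using q by (auto simp: Q_def)
      have "join F \<theta> \<phi> k \<in> clifford_angles" if "k < m" for k
        using \<theta>[of k] \<phi> that by (auto simp: join_def PiE_mem)
      then have x: "cos (join F \<theta> \<phi> k) = 0 \<or> sin (join F \<theta> \<phi> k) = 0" if "k < m" for k
        using that clifford_angles_cos_sin by blast
      have Z0: "1 * f j y \<in> \<int>" if "\<And>k. k < m \<Longrightarrow> cos (y k) = 0 \<or> sin (y k) = 0" for y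
        using fZ[OF jkl(2) that] by simp
      have Z1: "2 * 1 * partial k (f j) y \<in> \<int>"
        if "\<And>k. k < m \<Longrightarrow> cos (y k) = 0 \<or> sin (y k) = 0" for y k
        by (rule partial_lattice[OF f[OF jkl(2)] Z0 that])
      have Z2: "2 * (2 * 1) * partial k (partial l (f j)) y \<in> \<int>"
        if "\<And>k. k < m \<Longrightarrow> cos (y k) = 0 \<or> sin (y k) = 0" for y k l
        by (rule partial_lattice[OF multi_trig_partial[OF f[OF jkl(2)]] Z1 that])
      have "4 * h q (join F \<theta> \<phi>) \<in> \<int>"
      proof (cases "l = m")
        case True
        \<comment> \<open>First derivatives are already multiples of 1/2; doubling once more gives
          the factor 4 shared with the second derivatives.\<close>
        have "2 * (2 * 1 * partial k (f j) (join F \<theta> \<phi>)) \<in> \<int>"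
          by (rule Ints_mult[OF _ Z1[OF x]]) auto
        then show ?thesis using True by (simp add: h_def jkl(1))
      next
        case False
        then show ?thesis using Z2[OF x, where k = k and l = l] by (simp add: h_def jkl(1))
      qed
      then have "4 * h q (join F \<theta> \<phi>) = 0"
        by (rule Ints_nonzero_abs_less1) (use small in \<open>simp add: abs_mult\<close>)
      then show ?thesis by simp
    qed
    have "measure_pmf.prob (unif_clifford_F F) {\<phi>. approx_local_min m 0 L (join F \<theta> \<phi>)}
        \<ge> 1 - real (card Q) * B / (1/4)\<^sup>2"
    proof (rule measure_pmf.markov_union_bound[OF finQ, where h = "\<lambda>q \<phi>. h q (join F \<theta> \<phi>)"])
      show "AE \<phi> in unif_clifford_F F. (\<forall>q\<in>Q. \<bar>h q (join F \<theta> \<phi>)\<bar> < 1/4) \<longrightarrow>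
          \<phi> \<in> {\<phi>. approx_local_min m 0 L (join F \<theta> \<phi>)}"
        unfolding AE_measure_pmf_iff set
      proof (intro ballI impI CollectI)
        fix \<phi> assume \<phi>: "\<phi> \<in> ?S" and small: "\<forall>q\<in>Q. \<bar>h q (join F \<theta> \<phi>)\<bar> < 1/4"
        show "approx_local_min m 0 L (join F \<theta> \<phi>)"
          \<comment> \<open>With \<open>\<delta> = 0\<close> the factor \<open>cmax\<close>
            disappears from the conditions, so it is absent from the Clifford bound.\<close>
          by (rule good[of \<phi> 0]) (use zero[OF _ \<phi>] small in auto)
      qed
      show "integrable (unif_clifford_F F) (\<lambda>\<phi>. (h q (join F \<theta> \<phi>))\<^sup>2)" for q
        by (rule integrable_measure_pmf_finite) (simp add: set finS)
    qed (use hB mean[OF h] in auto)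
    \<comment> \<open>The factor 16 is the inverse square of the threshold 1/4; the cubic count is
      weakened to the ninth power to share the exponent of the continuous bound.\<close>
    moreover have "real (card Q) * B / (1/4)\<^sup>2 \<le> 16 * ?X ^ 9 * B"
    proof -
      have "real (card Q) \<le> ?X * (?X * ?X)" by (rule order_trans[OF cardQ]) (intro mult_mono, auto)
      also have "\<dots> = ?X ^ 3" by (simp add: eval_nat_numeral)
      also have "\<dots> \<le> ?X ^ 9" by (rule power_increasing) auto
      finally show ?thesis using B(1) by (simp add: power2_eq_square mult_left_mono mult.commute[of _ B])
    qed
    ultimately show ?thesis by linarith
  qed
qed

theorem theorem2:
  shows "\<exists>(K::real) (d::nat). \<forall>(n::nat) (N::nat) (m::nat) (c::nat \<Rightarrow> real) (cmax::real)
           (P::nat \<Rightarrow> nat \<Rightarrow> nat) (\<rho>::complex mat) (gs::gate list) (F::nat set)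
           (\<theta>::nat \<Rightarrow> real) (i::nat) (C::real) (b::real).
     stabilizer_state n \<rho> \<and> clifford_circuit n m gs \<and>
     (\<forall>j<N. is_pauli n (P j)) \<and> (\<forall>j<N. \<bar>c j\<bar> \<le> cmax) \<and> i < N \<and>
     F \<subseteq> {..<m} \<and> (\<forall>k\<in>{..<m} - F. \<theta> k \<in> clifford_angles) \<and>
     (\<forall>\<phi>\<in>PiE F (\<lambda>_. {0..<2*pi}). c i * ell n \<rho> gs (P i) (join F \<theta> \<phi>) = - \<bar>c i\<bar>) \<and>
     C > 0 \<and> b > 1 \<and>
     (\<forall>j<N. j \<noteq> i \<longrightarrow>
        (\<integral>\<phi>. (ell n \<rho> gs (P j) (join F \<theta> \<phi>))^2 \<partial>unif_F F) \<le> C / b^n) \<and>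
     (\<forall>a::nat \<Rightarrow> int. (\<forall>k. a k \<noteq> 0 \<longrightarrow> k \<in> {..<m} - F) \<and> card {k. a k \<noteq> 0} \<le> 2 \<longrightarrow>
        (\<forall>j<N. j \<noteq> i \<longrightarrow>
          (\<integral>\<phi>. (ell n \<rho> gs (P j) (join F (\<lambda>k. \<theta> k + real_of_int (a k) * (pi/2)) \<phi>))^2
              \<partial>unif_F F) \<le> C / b^n))
     \<longrightarrow>
     (\<forall>\<epsilon>::real. 0 < \<epsilon> \<and> \<epsilon> \<le> 1 \<longrightarrow>
        measure (unif_F F)
          {\<phi> \<in> space (unif_F F). approx_local_min m \<epsilon> (loss n \<rho> gs N c P) (join F \<theta> \<phi>)}
        \<ge> 1 - K * (1 + real N + real m + cmax)^d * C / (\<epsilon>^2 * b^n)) \<and>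
     measure_pmf.prob (unif_clifford_F F)
          {\<phi>. approx_local_min m 0 (loss n \<rho> gs N c P) (join F \<theta> \<phi>)}
        \<ge> 1 - K * (1 + real N + real m)^d * C / b^n"
proof (rule exI[of _ 16], rule exI[of _ 9], intro allI impI, elim conjE)
  fix n N m :: nat and c :: "nat \<Rightarrow> real" and cmax :: real and P :: "nat \<Rightarrow> nat \<Rightarrow> nat"
    and \<rho> :: "complex mat" and gs :: "gate list" and F :: "nat set" and \<theta> :: "nat \<Rightarrow> real"
    and i :: nat and C b :: real
  assume \<rho>: "stabilizer_state n \<rho>" and gs: "clifford_circuit n m gs"
    and P: "\<forall>j<N. is_pauli n (P j)" and c: "\<forall>j<N. \<bar>c j\<bar> \<le> cmax" and i: "i < N"
    and F: "F \<subseteq> {..<m}" and \<theta>: "\<forall>k\<in>{..<m} - F. \<theta> k \<in> clifford_angles"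
    and ci: "\<forall>\<phi>\<in>PiE F (\<lambda>_. {0..<2*pi}). c i * ell n \<rho> gs (P i) (join F \<theta> \<phi>) = - \<bar>c i\<bar>"
    and C: "C > 0" and b: "b > 1"
    and shifts: "\<forall>a::nat \<Rightarrow> int. (\<forall>k. a k \<noteq> 0 \<longrightarrow> k \<in> {..<m} - F) \<and> card {k. a k \<noteq> 0} \<le> 2 \<longrightarrow>
        (\<forall>j<N. j \<noteq> i \<longrightarrow>
          (\<integral>\<phi>. (ell n \<rho> gs (P j) (join F (\<lambda>k. \<theta> k + real_of_int (a k) * (pi/2)) \<phi>))^2
              \<partial>unif_F F) \<le> C / b^n)"
  have L: "loss n \<rho> gs N c P = (\<lambda>\<phi>. \<Sum>j<N. c j * ell n \<rho> gs (P j) \<phi>)"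
    by (simp add: fun_eq_iff loss_def)
  have cmax: "cmax \<ge> 0" using c i by (meson abs_ge_zero order_trans)
  have B: "C / b ^ n \<ge> 0" using C b by simp
  have SB: "shift_bounded m F \<theta> (C / b ^ n) 2 (ell n \<rho> gs (P j))" if "j < N" "j \<noteq> i" for j
    unfolding shift_bounded_def sq_mean_def using shifts that by blast
  have Z: "ell n \<rho> gs (P j) x \<in> \<int>"
    if "j < N" "\<And>k. k < m \<Longrightarrow> cos (x k) = 0 \<or> sin (x k) = 0" for j x
    by (rule ell_integer[OF \<rho> gs]) (use P that in auto)
  note bounds = landscape_bounds[of N m "\<lambda>j. ell n \<rho> gs (P j)" i c cmax F \<theta> "C / b ^ n", folded L]
  note hyps = multi_trig_ell[OF \<rho> gs] abs_ell_le_1[OF \<rho> gs] i c F \<theta> ci B SB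
  have "1 - 16 * (1 + real N + real m + cmax) ^ 9 * C / (\<epsilon>\<^sup>2 * b ^ n)
      \<le> measure (unif_F F) {\<phi> \<in> space (unif_F F). approx_local_min m \<epsilon> (loss n \<rho> gs N c P) (join F \<theta> \<phi>)}"
    if \<epsilon>: "0 < \<epsilon>" "\<epsilon> \<le> 1" for \<epsilon>
  proof -
    \<comment> \<open>The continuous bound holds with constant 1 and is weakened, so that the
      constant of the Clifford bound serves both.\<close>
    have le_16: "y \<le> 16 * y" if "y \<ge> 0" for y :: real using that by simp
    have "(1 + real N + real m + cmax) ^ 9 * (C / b ^ n) / \<epsilon>\<^sup>2 \<ge> 0"
      using cmax C b \<epsilon> by (intro divide_nonneg_nonneg mult_nonneg_nonneg zero_le_power) auto
    then have "(1 + real N + real m + cmax) ^ 9 * (C / b ^ n) / \<epsilon>\<^sup>2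
        \<le> 16 * ((1 + real N + real m + cmax) ^ 9 * (C / b ^ n) / \<epsilon>\<^sup>2)" by (rule le_16)
    also have "\<dots> = 16 * (1 + real N + real m + cmax) ^ 9 * C / (\<epsilon>\<^sup>2 * b ^ n)"
      by (simp add: mult_ac)
    finally have le: "(1 + real N + real m + cmax) ^ 9 * (C / b ^ n) / \<epsilon>\<^sup>2
        \<le> 16 * (1 + real N + real m + cmax) ^ 9 * C / (\<epsilon>\<^sup>2 * b ^ n)" .
    have "1 - (1 + real N + real m + cmax) ^ 9 * (C / b ^ n) / \<epsilon>\<^sup>2
        \<le> measure (unif_F F) {\<phi> \<in> space (unif_F F). approx_local_min m \<epsilon> (loss n \<rho> gs N c P) (join F \<theta> \<phi>)}"
      by (rule bounds(1)) (use hyps \<epsilon> in \<open>auto intro: Z\<close>)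
    then show ?thesis by (rule order_trans[OF diff_left_mono[OF le]])
  qed
  moreover have "1 - 16 * (1 + real N + real m) ^ 9 * (C / b ^ n)
      \<le> measure_pmf.prob (unif_clifford_F F) {\<phi>. approx_local_min m 0 (loss n \<rho> gs N c P) (join F \<theta> \<phi>)}"
    by (rule bounds(2)) (use hyps in \<open>auto intro: Z\<close>)
  ultimately show "(\<forall>\<epsilon>::real. 0 < \<epsilon> \<and> \<epsilon> \<le> 1 \<longrightarrow>
        measure (unif_F F)
          {\<phi> \<in> space (unif_F F). approx_local_min m \<epsilon> (loss n \<rho> gs N c P) (join F \<theta> \<phi>)}
        \<ge> 1 - 16 * (1 + real N + real m + cmax)^9 * C / (\<epsilon>^2 * b^n)) \<and>
     measure_pmf.prob (unif_clifford_F F)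
          {\<phi>. approx_local_min m 0 (loss n \<rho> gs N c P) (join F \<theta> \<phi>)}
        \<ge> 1 - 16 * (1 + real N + real m)^9 * C / b^n"
    by simp
qed

end
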